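(* Let $A$ be the Weyl algebra, let $\pi$ be its Schrödinger representation on $\mathcal S(\mathbb R)\subseteq L^2(\mathbb R)$, and for $\eta\in\mathcal S(\mathbb R)$ let $f_\eta(a)=\langle\pi(a)\eta,\eta\rangle$, $a\in A$. Suppose that $\varphi,\psi\in C_0^\infty(\mathbb R)$ both satisfy condition $( * )$, with associated intervals $\mathcal J_k(\varphi)$ and $\mathcal J_l(\psi)$, respectively. Then $$P_A(f_\varphi,f_\psi)=\left(\sum_{k,l}\left|\int_{\mathcal J_k(\varphi)\cap\mathcal J_l(\psi)}\varphi(x)\,\overline{\psi(x)}\,dx\right|\right)^2,$$ where the integral is set to be zero if $\mathcal J_k(\varphi)\cap\mathcal J_l(\psi)$ is empty.
   Context: The Weyl algebra $A$ is the complex unital $*$-algebra generated by two hermitian generators $p,q$ with the defining relation $pq-qp=-\mathrm i\,1$. Its Schrödinger representation $\pi$ on $\mathcal D(\pi)=\mathcal S(\mathbb R)\subseteq L^2(\mathbb R)$ is given by $(\pi(q)\varphi)(x)=x\varphi(x)$, $(\pi(p)\varphi)(x)=-\mathrm i\varphi'(x)$. Condition $( * )$ on a function $\eta$: there are finitely many mutually disjoint open intervals $\mathcal J_l(\eta)=(\alpha_l,\beta_l)$, $l=1,\dots,r$, such that $\eta(t)\ne0$ for $t\in\mathcal J(\eta):=\bigcup_l\mathcal J_l(\eta)$ and $\eta^{(n)}(t)=0$ for all $t\in\mathbb R\setminus\mathcal J(\eta)$ and all $n\in\mathbb N_0$. For a complex unital $*$-algebra $A$ with involution $a\mapsto a^+$,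 a linear functional $f$ is positive if $f(a^+a)\ge0$ for all $a\in A$. A $*$-representation $\pi$ of $A$ on a complex inner product space $\mathcal D(\pi)$ is an algebra homomorphism of $A$ into the linear operators $\mathcal D(\pi)\to\mathcal D(\pi)$ with $\pi(1)=I$ and $\langle\pi(a)\varphi,\psi\rangle=\langle\varphi,\pi(a^+)\psi\rangle$ for $a\in A$, $\varphi,\psi\in\mathcal D(\pi)$; inner products are linear in the first variable. $S(\pi,f)$ is the set of all $\varphi\in\mathcal D(\pi)$ with $f(a)=\langle\pi(a)\varphi,\varphi\rangle$ for all $a\in A$. The transition probability of positive linear functionals $f,g$ on $A$ is $$P_A(f,g)=\sup_{\pi}\ \sup_{\varphi\in S(\pi,f),\,\psi\in S(\pi,g)}|\langle\varphi,\psi\rangle|^2,$$ where $\pi$ ranges over all $*$-representations of $A$. *)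

theory Defs
  imports "HOL-Analysis.Analysis" "HOL-Library.Poly_Mapping" "HOL-Algebra.Module"
begin

section \<open>Complex unital *-algebras\<close>

class complex_star_algebra = ring_1 +
  fixes cscale :: "complex \<Rightarrow> 'a \<Rightarrow> 'a"  (infixr \<open>*\<^sub>C\<close> 75)
    and star :: "'a \<Rightarrow> 'a"
  assumes cscale_add_right: "c *\<^sub>C (a + b) = c *\<^sub>C a + c *\<^sub>C b"
    and cscale_add_left: "(c + d) *\<^sub>C a = c *\<^sub>C a + d *\<^sub>C a"
    and cscale_cscale: "c *\<^sub>C d *\<^sub>C a = (c * d) *\<^sub>C a"
    and cscale_one: "1 *\<^sub>C a = a"
    and cscale_mult_left: "(c *\<^sub>C a) * b = c *\<^sub>C (a * b)"
    and cscale_mult_right: "a * (c *\<^sub>C b) = c *\<^sub>C (a * b)"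
    and star_star: "star (star a) = a"
    and star_add: "star (a + b) = star a + star b"
    and star_cscale: "star (c *\<^sub>C a) = cnj c *\<^sub>C star a"
    and star_mult: "star (a * b) = star b * star a"


section \<open>*-representations and transition probability\<close>

definition complex_field :: "complex ring"
  where "complex_field = \<lparr>carrier = UNIV, monoid.mult = (*), one = 1, zero = 0, add = (+)\<rparr>"

text \<open>
  Inner products are linear in the first variable.  No completeness is required.
  The record type of modules extends that of rings; the fields for
  multiplication and unit of \<open>V\<close> play no role.
\<close>

locale complex_inner_product_space = module complex_field V
  for V :: "(complex, 'v) module" (structure) +
  fixes ip :: "'v \<Rightarrow> 'v \<Rightarrow> complex"
  assumes ip_add_left: "\<lbrakk>x \<in> carrier V; y \<in> carrier V; z \<in> carrier V\<rbrakk>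
      \<Longrightarrow> ip (x \<oplus>\<^bsub>V\<^esub> y) z = ip x z + ip y z"
    and ip_smult_left: "\<lbrakk>x \<in> carrier V; y \<in> carrier V\<rbrakk> \<Longrightarrow> ip (c \<odot>\<^bsub>V\<^esub> x) y = c * ip x y"
    and ip_commute: "\<lbrakk>x \<in> carrier V; y \<in> carrier V\<rbrakk> \<Longrightarrow> ip y x = cnj (ip x y)"
    and ip_self_nonneg: "x \<in> carrier V \<Longrightarrow> 0 \<le> Re (ip x x)"
    and ip_self_eq_zero: "\<lbrakk>x \<in> carrier V; ip x x = 0\<rbrakk> \<Longrightarrow> x = \<zero>\<^bsub>V\<^esub>"

locale star_representation = complex_inner_product_space V ip
  for V :: "(complex, 'v) module" (structure) and ip :: "'v \<Rightarrow> 'v \<Rightarrow> complex" +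
  fixes \<pi> :: "'a::complex_star_algebra \<Rightarrow> 'v \<Rightarrow> 'v"
  assumes rep_closed: "x \<in> carrier V \<Longrightarrow> \<pi> a x \<in> carrier V"
    and rep_linear_add: "\<lbrakk>x \<in> carrier V; y \<in> carrier V\<rbrakk>
      \<Longrightarrow> \<pi> a (x \<oplus>\<^bsub>V\<^esub> y) = \<pi> a x \<oplus>\<^bsub>V\<^esub> \<pi> a y"
    and rep_linear_smult: "x \<in> carrier V \<Longrightarrow> \<pi> a (c \<odot>\<^bsub>V\<^esub> x) = c \<odot>\<^bsub>V\<^esub> \<pi> a x"
    and rep_add: "x \<in> carrier V \<Longrightarrow> \<pi> (a + b) x = \<pi> a x \<oplus>\<^bsub>V\<^esub> \<pi> b x"
    and rep_cscale: "x \<in> carrier V \<Longrightarrow> \<pi> (c *\<^sub>C a) x = c \<odot>\<^bsub>V\<^esub> \<pi> a x"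
    and rep_mult: "x \<in> carrier V \<Longrightarrow> \<pi> (a * b) x = \<pi> a (\<pi> b x)"
    and rep_one: "x \<in> carrier V \<Longrightarrow> \<pi> 1 x = x"
    and rep_star: "\<lbrakk>x \<in> carrier V; y \<in> carrier V\<rbrakk> \<Longrightarrow> ip (\<pi> a x) y = ip x (\<pi> (star a) y)"

definition representing_vectors ::
  "(complex, 'v) module \<Rightarrow> ('v \<Rightarrow> 'v \<Rightarrow> complex) \<Rightarrow> ('a::complex_star_algebra \<Rightarrow> 'v \<Rightarrow> 'v)
    \<Rightarrow> ('a \<Rightarrow> complex) \<Rightarrow> 'v set"
  where "representing_vectors V ip \<pi> f = {x \<in> carrier V. \<forall>a. f a = ip (\<pi> a x) x}"

text \<open>
  The supremum over all *-representations is taken over all those whose space has a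
  subset of the type \<open>'v\<close> as its carrier, with arbitrary vector space
  operations and inner product.  A statement about \<open>transition_probability\<close> for all
  sufficiently large types \<open>'v\<close> is thus a statement about all *-representations.
  As every nonzero complex vector space has at least the cardinality of the continuum,
  a type into which the reals embed is large enough to carry nontrivial representations.
  By the Cauchy-Schwarz inequality the set below is bounded above (by \<open>Re (f 1) * Re (g 1)\<close>).
\<close>

definition transition_probability ::
  "'v itself \<Rightarrow> ('a::complex_star_algebra \<Rightarrow> complex) \<Rightarrow> ('a \<Rightarrow> complex) \<Rightarrow> real"
  where "transition_probability _ f g =
    Sup {(cmod (ip x y))\<^sup>2 | (V :: (complex, 'v) module) ip \<pi> x y.
      star_representation V ip \<pi> \<and>
      x \<in> representing_vectors V ip \<pi> f \<and> y \<in> representing_vectors V ip \<pi> g}"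


section \<open>Schwartz functions\<close>

definition vderiv :: "(real \<Rightarrow> complex) \<Rightarrow> real \<Rightarrow> complex"
  where "vderiv f = (\<lambda>x. vector_derivative f (at x))"

definition smooth :: "(real \<Rightarrow> complex) \<Rightarrow> bool"
  where "smooth f \<longleftrightarrow> (\<forall>n x. (vderiv ^^ n) f differentiable (at x))"

definition schwartz_space :: "(real \<Rightarrow> complex) set"
  where "schwartz_space =
    {f. smooth f \<and> (\<forall>m n. bounded (range (\<lambda>x. of_real x ^ m * (vderiv ^^ n) f x)))}"

definition test_functions :: "(real \<Rightarrow> complex) set"
  where "test_functions = {f. smooth f \<and> compact (closure {x. f x \<noteq> 0})}"

definition L2_inner :: "(real \<Rightarrow> complex) \<Rightarrow> (real \<Rightarrow> complex) \<Rightarrow> complex"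
  where "L2_inner f g = (LINT x|lborel. f x * cnj (g x))"

lemma smooth_has_vderiv:
  "smooth f \<Longrightarrow> ((vderiv ^^ n) f has_vector_derivative (vderiv ^^ Suc n) f x) (at x)"
  by (simp add: smooth_def vderiv_def vector_derivative_works)

lemma smooth_intro:
  assumes "F 0 = f" and "\<And>n x. (F n has_vector_derivative F (Suc n) x) (at x)"
  shows "smooth f" and "(vderiv ^^ n) f = F n"
proof -
  have eq: "(vderiv ^^ n) f = F n" for n
  proof (induction n)
    case 0
    show ?case by (simp add: assms(1))
  next
    case (Suc n)
    then show ?case
      by (simp add: vderiv_def vector_derivative_at[OF assms(2)])
  qed
  show "(vderiv ^^ n) f = F n" by (rule eq)
  show "smooth f"
    unfolding smooth_def eq using assms(2) by (blast intro: differentiableI_vector)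
qed

lemma smooth_vderiv: "smooth f \<Longrightarrow> smooth (vderiv f)"
  unfolding smooth_def by (metis comp_apply funpow_Suc_right)

lemma
  assumes "smooth f" "smooth g"
  shows smooth_add: "smooth (\<lambda>x. f x + g x)"
    and vderiv_add: "(vderiv ^^ n) (\<lambda>x. f x + g x) = (\<lambda>x. (vderiv ^^ n) f x + (vderiv ^^ n) g x)"
proof -
  let ?F = "\<lambda>n x. (vderiv ^^ n) f x + (vderiv ^^ n) g x"
  have F: "?F 0 = (\<lambda>x. f x + g x)" by simp
  have D: "(?F n has_vector_derivative ?F (Suc n) x) (at x)" for n x
    by (intro has_vector_derivative_add smooth_has_vderiv assms)
  show "smooth (\<lambda>x. f x + g x)" by (rule smooth_intro(1)[of ?F, OF F D])
  show "(vderiv ^^ n) (\<lambda>x. f x + g x) = ?F n" by (rule smooth_intro(2)[of ?F, OF F D])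
qed

lemma
  assumes "smooth f"
  shows smooth_cmult: "smooth (\<lambda>x. c * f x)"
    and vderiv_cmult: "(vderiv ^^ n) (\<lambda>x. c * f x) = (\<lambda>x. c * (vderiv ^^ n) f x)"
proof -
  let ?F = "\<lambda>n x. c * (vderiv ^^ n) f x"
  have F: "?F 0 = (\<lambda>x. c * f x)" by simp
  have D: "(?F n has_vector_derivative ?F (Suc n) x) (at x)" for n x
    by (intro has_vector_derivative_mult_right smooth_has_vderiv assms)
  show "smooth (\<lambda>x. c * f x)" by (rule smooth_intro(1)[of ?F, OF F D])
  show "(vderiv ^^ n) (\<lambda>x. c * f x) = ?F n" by (rule smooth_intro(2)[of ?F, OF F D])
qed

lemma
  assumes "smooth f"
  shows smooth_xmult: "smooth (\<lambda>x. of_real x * f x)"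
    and vderiv_xmult: "(vderiv ^^ n) (\<lambda>x. of_real x * f x) =
      (\<lambda>x. of_real x * (vderiv ^^ n) f x + of_nat n * (vderiv ^^ (n - 1)) f x)"
proof -
  let ?F = "\<lambda>n x. of_real x * (vderiv ^^ n) f x + of_nat n * (vderiv ^^ (n - 1)) f x"
  have F: "?F 0 = (\<lambda>x. of_real x * f x)" by simp
  have D: "(?F n has_vector_derivative ?F (Suc n) x) (at x)" for n x
  proof -
    have 1: "((\<lambda>x. of_real x * (vderiv ^^ n) f x) has_vector_derivative
        of_real x * (vderiv ^^ Suc n) f x + 1 * (vderiv ^^ n) f x) (at x)"
      by (intro has_vector_derivative_mult smooth_has_vderiv assms)
        (use has_vector_derivative_of_real[OF DERIV_ident] in auto)
    have 2: "((\<lambda>x. of_nat n * (vderiv ^^ (n - 1)) f x) has_vector_derivative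
        of_nat n * (vderiv ^^ n) f x) (at x)"
      using smooth_has_vderiv[OF assms, of "n - 1" x]
      by (cases n) (auto intro!: has_vector_derivative_mult_right)
    show ?thesis
      using has_vector_derivative_add[OF 1 2] by (simp add: algebra_simps)
  qed
  show "smooth (\<lambda>x. of_real x * f x)" by (rule smooth_intro(1)[of ?F, OF F D])
  show "(vderiv ^^ n) (\<lambda>x. of_real x * f x) = ?F n" by (rule smooth_intro(2)[of ?F, OF F D])
qed

lemma smooth_const: "smooth (\<lambda>x. c)"
  by (rule smooth_intro(1)[where F = "\<lambda>n x. if n = 0 then c else 0"]) auto

lemma smooth_sum: "(\<And>i. i \<in> I \<Longrightarrow> smooth (f i)) \<Longrightarrow> smooth (\<lambda>x. \<Sum>i\<in>I. f i x)"
  by (induction I rule: infinite_finite_induct) (auto intro: smooth_const smooth_add)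

lemma schwartz_space_smooth: "f \<in> schwartz_space \<Longrightarrow> smooth f"
  by (simp add: schwartz_space_def)

lemma schwartz_space_add:
  "f \<in> schwartz_space \<Longrightarrow> g \<in> schwartz_space \<Longrightarrow> (\<lambda>x. f x + g x) \<in> schwartz_space"
  unfolding schwartz_space_def
  by (auto simp: smooth_add vderiv_add distrib_left intro!: bounded_plus_comp)

lemma bounded_cmult_comp:
  fixes f :: "'a \<Rightarrow> complex"
  shows "bounded (f ` S) \<Longrightarrow> bounded ((\<lambda>x. c * f x) ` S)"
  using bounded_linear_image[OF _ bounded_linear_mult_right[of c], of "f ` S"]
  by (simp add: image_image)

lemma schwartz_space_cmult: "f \<in> schwartz_space \<Longrightarrow> (\<lambda>x. c * f x) \<in> schwartz_space"
  unfolding schwartz_space_def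
  by (auto simp: smooth_cmult vderiv_cmult mult.left_commute[of _ c] intro!: bounded_cmult_comp)

lemma schwartz_space_vderiv:
  assumes "f \<in> schwartz_space"
  shows "vderiv f \<in> schwartz_space"
proof -
  have "(vderiv ^^ n) (vderiv f) = (vderiv ^^ Suc n) f" for n
    by (simp add: funpow_Suc_right del: funpow.simps)
  with assms show ?thesis
    unfolding schwartz_space_def by (auto intro: smooth_vderiv simp del: funpow.simps)
qed

lemma schwartz_space_xmult:
  assumes "f \<in> schwartz_space"
  shows "(\<lambda>x. of_real x * f x) \<in> schwartz_space"
proof -
  have sm: "smooth f" using assms by (rule schwartz_space_smooth)
  have b: "bounded (range (\<lambda>x. of_real x ^ m * (vderiv ^^ n) f x))" for m n
    using assms by (simp add: schwartz_space_def)
  have "bounded (range (\<lambda>x. of_real x ^ Suc m * (vderiv ^^ n) f x +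
      of_nat n * (of_real x ^ m * (vderiv ^^ (n - 1)) f x)))" for m n
    by (intro bounded_plus_comp bounded_cmult_comp b)
  then show ?thesis
    unfolding schwartz_space_def
    by (simp add: smooth_xmult[OF sm] vderiv_xmult[OF sm] algebra_simps)
qed



section \<open>The Weyl algebra\<close>

text \<open>
  The monoid of words is written additively, so that \<open>'g free_word \<Rightarrow>\<^sub>0 complex\<close> carries the
  convolution product and thereby is the free complex algebra on \<open>'g\<close>.
\<close>

datatype 'g free_word = Word (letters: "'g list")

instantiation free_word :: (type) monoid_add
begin

definition zero_free_word :: "'a free_word"
  where "0 = Word []"

definition plus_free_word :: "'a free_word \<Rightarrow> 'a free_word \<Rightarrow> 'a free_word"
  where "v + w = Word (letters v @ letters w)"

instance
  by standard (simp_all add: zero_free_word_def plus_free_word_def)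

end

datatype weyl_gen = Gen_p | Gen_q

type_synonym free_algebra = "weyl_gen free_word \<Rightarrow>\<^sub>0 complex"

abbreviation free_const :: "complex \<Rightarrow> free_algebra"
  where "free_const c \<equiv> Poly_Mapping.single 0 c"

abbreviation free_gen :: "weyl_gen \<Rightarrow> free_algebra"
  where "free_gen g \<equiv> Poly_Mapping.single (Word [g]) 1"

abbreviation word_rev :: "'g free_word \<Rightarrow> 'g free_word"
  where "word_rev w \<equiv> Word (rev (letters w))"

text \<open>The involution of the free algebra for which the generators are hermitian.\<close>

lift_definition free_star :: "free_algebra \<Rightarrow> free_algebra"
  is "\<lambda>a w. cnj (a (word_rev w))"
proof -
  fix a :: "weyl_gen free_word \<Rightarrow> complex"
  assume "finite {w. a w \<noteq> 0}"
  moreover have "{w. cnj (a (word_rev w)) \<noteq> 0} \<subseteq> word_rev ` {w. a w \<noteq> 0}"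
  proof
    fix w assume "w \<in> {w. cnj (a (word_rev w)) \<noteq> 0}"
    then show "w \<in> word_rev ` {w. a w \<noteq> 0}"
      by (intro image_eqI[of _ _ "word_rev w"]) auto
  qed
  ultimately show "finite {w. cnj (a (word_rev w)) \<noteq> 0}"
    by (meson finite_imageI finite_subset)
qed

definition weyl_relator :: free_algebra
  where "weyl_relator =
    free_gen Gen_p * free_gen Gen_q - free_gen Gen_q * free_gen Gen_p + free_const \<i>"

inductive_set weyl_ideal :: "free_algebra set" where
  sandwich: "a * weyl_relator * b \<in> weyl_ideal"
| add: "a \<in> weyl_ideal \<Longrightarrow> b \<in> weyl_ideal \<Longrightarrow> a + b \<in> weyl_ideal"

lemma weyl_ideal_mult: "a \<in> weyl_ideal \<Longrightarrow> c * a * d \<in> weyl_ideal"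
proof (induction rule: weyl_ideal.induct)
  case (sandwich a b)
  have "c * (a * weyl_relator * b) * d = (c * a) * weyl_relator * (b * d)"
    by (simp only: mult.assoc)
  then show ?case by (simp only: weyl_ideal.sandwich)
next
  case (add a b)
  then show ?case by (simp add: distrib_left distrib_right weyl_ideal.add)
qed

lemma weyl_ideal_mult_left: "a \<in> weyl_ideal \<Longrightarrow> c * a \<in> weyl_ideal"
  using weyl_ideal_mult[of a c 1] by simp

lemma weyl_ideal_mult_right: "a \<in> weyl_ideal \<Longrightarrow> a * d \<in> weyl_ideal"
  using weyl_ideal_mult[of a 1 d] by simp

lemma weyl_ideal_zero: "0 \<in> weyl_ideal"
  using weyl_ideal.sandwich[of 0 0] by simp

lemma weyl_ideal_uminus: "a \<in> weyl_ideal \<Longrightarrow> - a \<in> weyl_ideal"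
  using weyl_ideal_mult_left[of a "-1"] by simp

lemma free_algebra_induct [case_names zero single add]:
  fixes a :: free_algebra
  assumes zero: "P 0"
    and single: "\<And>w c. P (Poly_Mapping.single w c)"
    and add: "\<And>a b. P a \<Longrightarrow> P b \<Longrightarrow> P (a + b)"
  shows "P a"
proof (induction a rule: update_induct)
  case const
  have "Poly_Mapping.keys a = {} \<Longrightarrow> a = 0" for a :: free_algebra by simp
  then show ?case using zero by simp
next
  case (update f a b)
  have "Poly_Mapping.update a b f = Poly_Mapping.single a b + f"
    using update(1)
    by (intro poly_mapping_eqI)
      (auto simp: lookup_update lookup_add lookup_single in_keys_iff when_def)
  then show ?case using update add single by simp
qed

lemma free_const_commute: "free_const c * a = a * free_const c"
  by (induction a rule: free_algebra_induct)
    (simp_all add: distrib_left distrib_right mult_single mult.commute)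

lemma word_rev_zero [simp]: "word_rev 0 = 0"
  by (simp add: zero_free_word_def)

lemma word_rev_plus: "word_rev (v + w) = word_rev w + word_rev v"
  by (simp add: plus_free_word_def)

lemma free_star_single:
  "free_star (Poly_Mapping.single w c) = Poly_Mapping.single (word_rev w) (cnj c)"
proof (rule poly_mapping_eqI)
  fix v
  have "w = word_rev v \<longleftrightarrow> word_rev w = v"
    by (cases v; cases w) auto
  then show "Poly_Mapping.lookup (free_star (Poly_Mapping.single w c)) v =
      Poly_Mapping.lookup (Poly_Mapping.single (word_rev w) (cnj c)) v"
    by (simp add: free_star.rep_eq lookup_single when_def)
qed

lemma free_star_add: "free_star (a + b) = free_star a + free_star b"
  by (rule poly_mapping_eqI) (simp add: free_star.rep_eq lookup_add)

lemma free_star_uminus: "free_star (- a) = - free_star a"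
  by (rule poly_mapping_eqI) (simp add: free_star.rep_eq)

lemma free_star_diff: "free_star (a - b) = free_star a - free_star b"
  by (rule poly_mapping_eqI) (simp add: free_star.rep_eq lookup_minus)

lemma free_star_zero: "free_star 0 = 0"
  by (rule poly_mapping_eqI) (simp add: free_star.rep_eq)

lemma free_star_star: "free_star (free_star a) = a"
  by (rule poly_mapping_eqI) (simp add: free_star.rep_eq)

lemma free_star_mult: "free_star (a * b) = free_star b * free_star a"
proof (induction a rule: free_algebra_induct)
  case zero
  then show ?case by (simp add: free_star_zero)
next
  case (single v c)
  show ?case
    by (induction b rule: free_algebra_induct)
      (simp_all add: free_star_zero free_star_single free_star_add mult_single word_rev_plus
        distrib_left distrib_right mult.commute)
next
  case (add a1 a2)
  then show ?case by (simp add: free_star_add distrib_left distrib_right)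
qed

lemma free_star_relator: "free_star weyl_relator = - weyl_relator"
  by (simp add: weyl_relator_def free_star_add free_star_diff free_star_mult free_star_single
      zero_free_word_def single_uminus)

lemma free_star_weyl_ideal: "a \<in> weyl_ideal \<Longrightarrow> free_star a \<in> weyl_ideal"
proof (induction rule: weyl_ideal.induct)
  case (sandwich a b)
  have "free_star (a * weyl_relator * b) = (- free_star b) * weyl_relator * free_star a"
    by (simp add: free_star_mult free_star_relator mult.assoc)
  then show ?case by (simp only: weyl_ideal.sandwich)
next
  case (add a b)
  then show ?case by (simp add: free_star_add weyl_ideal.add)
qed


subsection \<open>The action of the free algebra by differential operators\<close>

fun gen_op :: "weyl_gen \<Rightarrow> (real \<Rightarrow> complex) \<Rightarrow> real \<Rightarrow> complex"
  where
    "gen_op Gen_p f = (\<lambda>x. - \<i> * vderiv f x)"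
  | "gen_op Gen_q f = (\<lambda>x. of_real x * f x)"

definition word_op :: "weyl_gen free_word \<Rightarrow> (real \<Rightarrow> complex) \<Rightarrow> real \<Rightarrow> complex"
  where "word_op w = foldr gen_op (letters w)"

definition free_op :: "free_algebra \<Rightarrow> (real \<Rightarrow> complex) \<Rightarrow> real \<Rightarrow> complex"
  where "free_op a f = (\<lambda>x. \<Sum>w\<in>Poly_Mapping.keys a. Poly_Mapping.lookup a w * word_op w f x)"

lemma smooth_gen_op: "smooth f \<Longrightarrow> smooth (gen_op g f)"
  by (cases g) (auto intro: smooth_cmult[of _ "-\<i>", simplified] smooth_xmult smooth_vderiv)

lemma gen_op_add:
  "smooth f \<Longrightarrow> smooth h \<Longrightarrow> gen_op g (\<lambda>x. f x + h x) = (\<lambda>x. gen_op g f x + gen_op g h x)"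
  using vderiv_add[of f h 1] by (cases g) (simp_all add: algebra_simps)

lemma gen_op_cmult: "smooth f \<Longrightarrow> gen_op g (\<lambda>x. c * f x) = (\<lambda>x. c * gen_op g f x)"
  using vderiv_cmult[of f 1 c] by (cases g) (simp_all add: algebra_simps)

lemma word_op_Cons: "word_op (Word (g # gs)) f = gen_op g (word_op (Word gs) f)"
  by (simp add: word_op_def)

lemma word_op_Nil: "word_op (Word []) f = f"
  by (simp add: word_op_def)

lemma word_op_plus: "word_op (v + w) f = word_op v (word_op w f)"
  by (simp add: word_op_def plus_free_word_def)

lemma smooth_word_op: "smooth f \<Longrightarrow> smooth (word_op w f)"
proof (induction w)
  case (Word gs)
  then show ?case by (induction gs) (auto simp: word_op_Nil word_op_Cons smooth_gen_op)
qed

lemma word_op_add: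
  assumes "smooth f" "smooth h"
  shows "word_op w (\<lambda>x. f x + h x) = (\<lambda>x. word_op w f x + word_op w h x)"
proof (induction w)
  case (Word gs)
  show ?case
    by (induction gs) (auto simp: word_op_Nil word_op_Cons smooth_word_op gen_op_add assms)
qed

lemma word_op_cmult:
  assumes "smooth f"
  shows "word_op w (\<lambda>x. c * f x) = (\<lambda>x. c * word_op w f x)"
proof (induction w)
  case (Word gs)
  show ?case
    by (induction gs) (auto simp: word_op_Nil word_op_Cons smooth_word_op gen_op_cmult assms)
qed

lemma free_op_superset:
  assumes "finite S" "Poly_Mapping.keys a \<subseteq> S"
  shows "free_op a f = (\<lambda>x. \<Sum>w\<in>S. Poly_Mapping.lookup a w * word_op w f x)"
  unfolding free_op_def using assms
  by (intro ext sum.mono_neutral_left) (auto simp: in_keys_iff)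

lemma free_op_zero: "free_op 0 f = (\<lambda>x. 0)"
  by (simp add: free_op_def)

lemma free_op_single: "free_op (Poly_Mapping.single w c) f = (\<lambda>x. c * word_op w f x)"
  by (subst free_op_superset[of "{w}"]) auto

lemma free_op_one: "free_op 1 f = f"
  using free_op_single[of 0 1 f] unfolding single_one by (simp add: zero_free_word_def word_op_Nil)

lemma free_op_add: "free_op (a + b) f = (\<lambda>x. free_op a f x + free_op b f x)"
proof -
  let ?S = "Poly_Mapping.keys a \<union> Poly_Mapping.keys b"
  have "free_op c f = (\<lambda>x. \<Sum>w\<in>?S. Poly_Mapping.lookup c w * word_op w f x)"
    if "c \<in> {a, b, a + b}" for c
    using that keys_add[of a b] by (intro free_op_superset) auto
  then show ?thesis
    by (simp add: lookup_add distrib_right sum.distrib)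
qed

lemma smooth_free_op: "smooth f \<Longrightarrow> smooth (free_op a f)"
  unfolding free_op_def by (intro smooth_sum smooth_cmult smooth_word_op)

lemma free_op_add_right:
  assumes "smooth f" "smooth h"
  shows "free_op a (\<lambda>x. f x + h x) = (\<lambda>x. free_op a f x + free_op a h x)"
  using assms by (simp add: free_op_def word_op_add distrib_left sum.distrib)

lemma free_op_cmult_right:
  assumes "smooth f"
  shows "free_op a (\<lambda>x. c * f x) = (\<lambda>x. c * free_op a f x)"
  using assms by (simp add: free_op_def word_op_cmult sum_distrib_left mult.left_commute)

lemma free_op_zero_right: "free_op a (\<lambda>x. 0) = (\<lambda>x. 0)"
  using free_op_cmult_right[OF smooth_const, of a 0 0] by simp

lemma free_op_mult:
  assumes "smooth f"
  shows "free_op (a * b) f = free_op a (free_op b f)"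
proof (induction a rule: free_algebra_induct)
  case zero
  show ?case by (simp add: free_op_zero)
next
  case (add a1 a2)
  then show ?case by (simp add: free_op_add distrib_right)
next
  case (single v c)
  show ?case
  proof (induction b rule: free_algebra_induct)
    case zero
    show ?case by (simp add: free_op_zero free_op_zero_right)
  next
    case (single w d)
    show ?case
      using assms
      by (simp add: mult_single free_op_single word_op_plus word_op_cmult smooth_word_op mult.assoc)
  next
    case (add b1 b2)
    then show ?case
      using assms by (simp add: free_op_add free_op_add_right smooth_free_op distrib_left)
  qed
qed

lemma free_op_relator:
  assumes "smooth f"
  shows "free_op weyl_relator f = (\<lambda>x. 0)"
proof -
  have *: "free_op (- a) f = (\<lambda>x. - free_op a f x)" for a
    by (simp add: free_op_def sum_negf)
  have gen: "free_op (free_gen g) h = gen_op g h" for g h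
    by (simp add: free_op_single word_op_Cons word_op_Nil)
  have const: "free_op (free_const c) h = (\<lambda>x. c * h x)" for c h
    by (simp add: free_op_single zero_free_word_def word_op_Nil)
  show ?thesis
    unfolding weyl_relator_def diff_conv_add_uminus free_op_add *
    using vderiv_xmult[OF assms, of 1] by (simp add: assms free_op_mult gen const algebra_simps)
qed

lemma free_op_weyl_ideal:
  assumes "smooth f"
  shows "a \<in> weyl_ideal \<Longrightarrow> free_op a f = (\<lambda>x. 0)"
proof (induction rule: weyl_ideal.induct)
  case (sandwich a b)
  show ?case
    using assms by (simp add: free_op_mult free_op_relator smooth_free_op free_op_zero_right)
next
  case (add a b)
  then show ?case by (simp add: free_op_add)
qed

lemma one_notin_weyl_ideal: "1 \<notin> weyl_ideal"
proof
  assume "1 \<in> weyl_ideal"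
  then have "free_op (Poly_Mapping.single 0 1) (\<lambda>x. 1) = (\<lambda>x. 0)"
    using free_op_weyl_ideal[OF smooth_const] by simp
  then show False
    by (simp add: free_op_single zero_free_word_def word_op_Nil fun_eq_iff)
qed

lemma schwartz_space_free_op:
  assumes "f \<in> schwartz_space"
  shows "free_op a f \<in> schwartz_space"
proof -
  have gen: "gen_op g h \<in> schwartz_space" if "h \<in> schwartz_space" for g h
    using that schwartz_space_cmult[OF schwartz_space_vderiv, of h "-\<i>"]
    by (cases g) (auto intro: schwartz_space_xmult)
  have word: "word_op w f \<in> schwartz_space" for w
  proof (induction w)
    case (Word gs)
    show ?case by (induction gs) (auto simp: word_op_Nil word_op_Cons gen assms)
  qed
  show ?thesis
  proof (induction a rule: free_algebra_induct)
    case zero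
    show ?case
      using schwartz_space_cmult[OF assms, of 0] by (simp add: free_op_zero)
  qed (simp_all add: free_op_single free_op_add schwartz_space_add schwartz_space_cmult word)
qed


subsection \<open>The Weyl algebra as a quotient of the free algebra\<close>

quotient_type weyl = "free_algebra" / "\<lambda>a b. a - b \<in> weyl_ideal"
proof (rule equivpI)
  show "reflp (\<lambda>a b. a - b \<in> weyl_ideal)"
    by (simp add: reflp_def weyl_ideal_zero)
  show "symp (\<lambda>a b. a - b \<in> weyl_ideal)"
    unfolding symp_def using weyl_ideal_uminus by fastforce
  show "transp (\<lambda>a b. a - b \<in> weyl_ideal)"
    unfolding transp_def using weyl_ideal.add by fastforce
qed

instantiation weyl :: complex_star_algebra
begin

lift_definition zero_weyl :: weyl is 0 .

lift_definition one_weyl :: weyl is 1 .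

lift_definition plus_weyl :: "weyl \<Rightarrow> weyl \<Rightarrow> weyl" is "(+)"
  by (metis add_diff_add weyl_ideal.add)

lift_definition uminus_weyl :: "weyl \<Rightarrow> weyl" is uminus
  by (metis minus_diff_minus weyl_ideal_uminus)

lift_definition minus_weyl :: "weyl \<Rightarrow> weyl \<Rightarrow> weyl" is "(-)"
proof -
  fix a a' b b' :: free_algebra
  assume "a - a' \<in> weyl_ideal" "b - b' \<in> weyl_ideal"
  then have "(a - a') + - (b - b') \<in> weyl_ideal"
    by (intro weyl_ideal.add weyl_ideal_uminus)
  then show "(a - b) - (a' - b') \<in> weyl_ideal"
    by (simp add: algebra_simps)
qed

lift_definition times_weyl :: "weyl \<Rightarrow> weyl \<Rightarrow> weyl" is "(*)"
proof -
  fix a a' b b' :: free_algebra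
  assume "a - a' \<in> weyl_ideal" "b - b' \<in> weyl_ideal"
  then have "(a - a') * b + a' * (b - b') \<in> weyl_ideal"
    by (intro weyl_ideal.add weyl_ideal_mult_left weyl_ideal_mult_right)
  then show "a * b - a' * b' \<in> weyl_ideal"
    by (simp add: algebra_simps)
qed

lift_definition cscale_weyl :: "complex \<Rightarrow> weyl \<Rightarrow> weyl" is "\<lambda>c a. free_const c * a"
  by (metis right_diff_distrib weyl_ideal_mult_left)

lift_definition star_weyl :: "weyl \<Rightarrow> weyl" is free_star
  by (metis free_star_diff free_star_weyl_ideal)

instance
proof
  fix a b c :: weyl and z w :: complex
  note [simp] = weyl_ideal_zero
  show "a + b + c = a + (b + c)" by transfer (simp add: algebra_simps)
  show "a + b = b + a" by transfer (simp add: algebra_simps)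
  show "0 + a = a" by transfer simp
  show "- a + a = 0" by transfer simp
  show "a - b = a + - b" by transfer simp
  show "a * b * c = a * (b * c)" by transfer (simp add: mult.assoc)
  show "1 * a = a" by transfer simp
  show "a * 1 = a" by transfer simp
  show "(a + b) * c = a * c + b * c" by transfer (simp add: distrib_right)
  show "a * (b + c) = a * b + a * c" by transfer (simp add: distrib_left)
  show "z *\<^sub>C (a + b) = z *\<^sub>C a + z *\<^sub>C b" by transfer (simp add: distrib_left)
  show "(z + w) *\<^sub>C a = z *\<^sub>C a + w *\<^sub>C a"
    by transfer (simp add: single_add distrib_right)
  show "z *\<^sub>C w *\<^sub>C a = (z * w) *\<^sub>C a"
    by transfer (simp add: mult_single flip: mult.assoc)
  show "1 *\<^sub>C a = a" by transfer simp
  show "(z *\<^sub>C a) * b = z *\<^sub>C (a * b)" by transfer (simp add: mult.assoc)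
  show "a * (z *\<^sub>C b) = z *\<^sub>C (a * b)"
  proof transfer
    fix a b :: free_algebra and z
    have "a * (free_const z * b) = free_const z * (a * b)"
      by (metis free_const_commute mult.assoc)
    then show "a * (free_const z * b) - free_const z * (a * b) \<in> weyl_ideal" by simp
  qed
  show "star (star a) = a" by transfer (simp add: free_star_star)
  show "star (a + b) = star a + star b" by transfer (simp add: free_star_add)
  show "star (z *\<^sub>C a) = cnj z *\<^sub>C star a"
    by transfer (simp add: free_star_mult free_star_single free_const_commute)
  show "star (a * b) = star b * star a" by transfer (simp add: free_star_mult)
  show "(0::weyl) \<noteq> 1"
    by transfer (use one_notin_weyl_ideal weyl_ideal_uminus in force)
qed

end

lift_definition weyl_p :: weyl is "free_gen Gen_p" .

lift_definition weyl_q :: weyl is "free_gen Gen_q" .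

lemma weyl_relation: "weyl_p * weyl_q - weyl_q * weyl_p = - (\<i> *\<^sub>C 1)"
proof transfer
  have "free_gen Gen_p * free_gen Gen_q - free_gen Gen_q * free_gen Gen_p -
      - (free_const \<i> * 1) = 1 * weyl_relator * 1"
    by (simp add: weyl_relator_def)
  then show "free_gen Gen_p * free_gen Gen_q - free_gen Gen_q * free_gen Gen_p -
      - (free_const \<i> * 1) \<in> weyl_ideal"
    by (simp only: weyl_ideal.sandwich)
qed

lemma star_weyl_p: "star weyl_p = weyl_p" and star_weyl_q: "star weyl_q = weyl_q"
  by (transfer; simp add: free_star_single weyl_ideal_zero)+


section \<open>The Schroedinger representation\<close>

text \<open>The domain is \<open>schwartz_space\<close>; other functions are sent to zero.\<close>

lift_definition schrodinger :: "weyl \<Rightarrow> (real \<Rightarrow> complex) \<Rightarrow> real \<Rightarrow> complex"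
  is "\<lambda>a f. if f \<in> schwartz_space then free_op a f else (\<lambda>x. 0)"
proof (rule ext)
  fix a b :: free_algebra and f :: "real \<Rightarrow> complex"
  assume "a - b \<in> weyl_ideal"
  then have "free_op a f = free_op b f" if "f \<in> schwartz_space"
    using free_op_add[of "a - b" b f]
    by (simp add: free_op_weyl_ideal[OF schwartz_space_smooth[OF that]])
  then show "(if f \<in> schwartz_space then free_op a f else (\<lambda>x. 0)) =
      (if f \<in> schwartz_space then free_op b f else (\<lambda>x. 0))" by simp
qed

lemma
  assumes "f \<in> schwartz_space"
  shows schrodinger_closed: "schrodinger a f \<in> schwartz_space"
    and schrodinger_p: "schrodinger weyl_p f = (\<lambda>x. - \<i> * vderiv f x)"
    and schrodinger_q: "schrodinger weyl_q f = (\<lambda>x. of_real x * f x)"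
    and schrodinger_one: "schrodinger 1 f = f"
    and schrodinger_add: "schrodinger (a + b) f = (\<lambda>x. schrodinger a f x + schrodinger b f x)"
    and schrodinger_cscale: "schrodinger (c *\<^sub>C a) f = (\<lambda>x. c * schrodinger a f x)"
    and schrodinger_mult: "schrodinger (a * b) f = schrodinger a (schrodinger b f)"
proof -
  show "schrodinger a f \<in> schwartz_space"
    using assms by transfer (simp add: schwartz_space_smooth schwartz_space_free_op)
  show "schrodinger weyl_p f = (\<lambda>x. - \<i> * vderiv f x)"
    using assms by transfer (simp add: schwartz_space_smooth free_op_single word_op_Cons word_op_Nil)
  show "schrodinger weyl_q f = (\<lambda>x. of_real x * f x)"
    using assms by transfer (simp add: schwartz_space_smooth free_op_single word_op_Cons word_op_Nil)
  show "schrodinger 1 f = f"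
    using assms by transfer (simp add: free_op_one)
  show "schrodinger (a + b) f = (\<lambda>x. schrodinger a f x + schrodinger b f x)"
    using assms by transfer (simp add: schwartz_space_smooth free_op_add)
  show "schrodinger (c *\<^sub>C a) f = (\<lambda>x. c * schrodinger a f x)"
    using assms by transfer (simp add: schwartz_space_smooth free_op_mult free_op_single zero_free_word_def word_op_Nil)
  show "schrodinger (a * b) f = schrodinger a (schrodinger b f)"
    using assms by transfer (simp add: schwartz_space_smooth free_op_mult schwartz_space_free_op)
qed

definition vector_functional :: "(real \<Rightarrow> complex) \<Rightarrow> weyl \<Rightarrow> complex"
  where "vector_functional \<eta> a = L2_inner (schrodinger a \<eta>) \<eta>"

definition interval_condition ::
  "(real \<Rightarrow> complex) \<Rightarrow> nat \<Rightarrow> (nat \<Rightarrow> real) \<Rightarrow> (nat \<Rightarrow> real) \<Rightarrow> bool"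
  where "interval_condition \<eta> r \<alpha> \<beta> \<longleftrightarrow>
    (\<forall>l\<in>{1..r}. \<alpha> l < \<beta> l) \<and>
    disjoint_family_on (\<lambda>l. {\<alpha> l<..<\<beta> l}) {1..r} \<and>
    (\<forall>t \<in> (\<Union>l\<in>{1..r}. {\<alpha> l<..<\<beta> l}). \<eta> t \<noteq> 0) \<and>
    (\<forall>t \<in> - (\<Union>l\<in>{1..r}. {\<alpha> l<..<\<beta> l}). \<forall>n. (vderiv ^^ n) \<eta> t = 0)"

end

theory Submission
  imports Defs "HOL-Computational_Algebra.Polynomial"
begin

text \<open>
  Lower bound: on pairs \<open>(u, v)\<close> of functions that are flat off \<open>\<J>(\<phi>)\<close> and off \<open>\<J>(\<psi>)\<close>,
  respectively, the algebra acts diagonally.  Perturb the inner product of the direct sum by cross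
  terms \<open>\<tau>\<^sub>k\<^sub>l \<integral> u(x) cnj (v(x)) dx\<close> over \<open>\<J>\<^sub>k(\<phi>) \<inter> \<J>\<^sub>l(\<psi>)\<close>.  No boundary terms arise, so the action
  stays a *-representation, and \<open>|\<tau>\<^sub>k\<^sub>l| < 1\<close> keeps the form positive definite.  Choose the phases
  of \<open>\<tau>\<^sub>k\<^sub>l\<close> to make all terms of \<open>\<langle>(\<phi>, 0), (0, \<psi>)\<rangle>\<close> nonnegative and let \<open>|\<tau>\<^sub>k\<^sub>l| \<rightarrow> 1\<close>.

  Upper bound: if \<open>x\<close> and \<open>y\<close> represent the two functionals, then \<open>\<langle>\<pi>(P(q))x, y\<rangle>\<close> is a functional of the
  polynomial \<open>P\<close> which, by Cauchy-Schwarz and Weierstrass, extends to continuous functions.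
  Commutation with \<open>p\<close> says that, divided by \<open>\<phi> cnj \<psi>\<close>, it annihilates derivatives of functions
  with compact support in \<open>\<J>\<^sub>k(\<phi>) \<inter> \<J>\<^sub>l(\<psi>)\<close>.  There it is thus \<open>\<kappa>\<^sub>k\<^sub>l \<integral> f \<phi> cnj \<psi>\<close> with \<open>|\<kappa>\<^sub>k\<^sub>l| \<le> 1\<close>,
  and exhausting the intervals by cutoffs gives \<open>\<langle>x, y\<rangle> = \<Sum> \<kappa>\<^sub>k\<^sub>l \<integral> \<phi> cnj \<psi>\<close>.
\<close>

section \<open>Symmetry of the Schroedinger representation on flat functions\<close>

text \<open>The gauge integral over a closed interval admits the fundamental theorem of calculus
  directly. For \<open>b < a\<close> the interval is empty and the value zero, as the theorem
  demands for empty intersections.\<close>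

definition pairing :: "real \<Rightarrow> real \<Rightarrow> (real \<Rightarrow> complex) \<Rightarrow> (real \<Rightarrow> complex) \<Rightarrow> complex"
  where "pairing a b u v = integral {a..b} (\<lambda>x. u x * cnj (v x))"

text \<open>Vanishing of all derivatives makes the space invariant under \<open>p\<close> as well as
  \<open>q\<close>. At a common endpoint of two adjacent intervals it does not follow from
  \<open>u t = 0\<close>.\<close>

definition flat_off :: "real set \<Rightarrow> (real \<Rightarrow> complex) set"
  where "flat_off U = {u \<in> schwartz_space. \<forall>n. \<forall>t\<in>-U. (vderiv ^^ n) u t = 0}"

lemma smooth_continuous_on: "smooth f \<Longrightarrow> continuous_on S f"
  using smooth_has_vderiv[of f 0]
  by (auto intro!: continuous_at_imp_continuous_on has_vector_derivative_continuous)

lemma flat_off_schwartz: "u \<in> flat_off U \<Longrightarrow> u \<in> schwartz_space"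
  and flat_off_smooth: "u \<in> flat_off U \<Longrightarrow> smooth u"
  and flat_off_zero: "u \<in> flat_off U \<Longrightarrow> t \<notin> U \<Longrightarrow> u t = 0"
  unfolding flat_off_def schwartz_space_def by (auto dest!: spec[of _ "0::nat"])

lemma flat_off_continuous_on: "u \<in> flat_off U \<Longrightarrow> continuous_on S u"
  by (simp add: flat_off_smooth smooth_continuous_on)

lemma flat_off_zero_fun: "(\<lambda>x. 0) \<in> flat_off U"
proof -
  have "(vderiv ^^ n) (\<lambda>x. 0) = (\<lambda>x. 0)" for n
    using vderiv_cmult[OF smooth_const, of n 0 0] by simp
  then show ?thesis
    by (auto simp: flat_off_def schwartz_space_def smooth_const)
qed

lemma flat_off_add: "u \<in> flat_off U \<Longrightarrow> v \<in> flat_off U \<Longrightarrow> (\<lambda>x. u x + v x) \<in> flat_off U"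
  by (simp add: flat_off_def schwartz_space_add vderiv_add schwartz_space_smooth)

lemma flat_off_cmult: "u \<in> flat_off U \<Longrightarrow> (\<lambda>x. c * u x) \<in> flat_off U"
  by (simp add: flat_off_def schwartz_space_cmult vderiv_cmult schwartz_space_smooth)

lemma flat_off_gen_op: "u \<in> flat_off U \<Longrightarrow> gen_op g u \<in> flat_off U"
proof (cases g)
  case Gen_p
  assume u: "u \<in> flat_off U"
  have "(vderiv ^^ n) (vderiv u) = (vderiv ^^ Suc n) u" for n
    by (simp add: funpow_Suc_right del: funpow.simps)
  then have "vderiv u \<in> flat_off U"
    using u unfolding flat_off_def by (auto intro: schwartz_space_vderiv simp del: funpow.simps)
  from flat_off_cmult[OF this, of "-\<i>"] show ?thesis by (simp add: Gen_p)
next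
  case Gen_q
  assume "u \<in> flat_off U"
  then show ?thesis
    by (simp add: Gen_q flat_off_def schwartz_space_xmult vderiv_xmult schwartz_space_smooth)
qed

lemma flat_off_word_op: "u \<in> flat_off U \<Longrightarrow> word_op w u \<in> flat_off U"
proof (induction w)
  case (Word gs)
  then show ?case by (induction gs) (auto simp: word_op_Nil word_op_Cons flat_off_gen_op)
qed

lemma flat_off_free_op: "u \<in> flat_off U \<Longrightarrow> free_op a u \<in> flat_off U"
  by (induction a rule: free_algebra_induct)
    (simp_all add: free_op_zero free_op_single free_op_add flat_off_zero_fun flat_off_cmult
      flat_off_add flat_off_word_op)

lemma schrodinger_abs: "u \<in> schwartz_space \<Longrightarrow> schrodinger (abs_weyl a) u = free_op a u"
  by (simp add: schrodinger.abs_eq)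

lemma flat_off_schrodinger: "u \<in> flat_off U \<Longrightarrow> schrodinger a u \<in> flat_off U"
  by (induction a rule: weyl.abs_induct) (simp add: schrodinger_abs flat_off_schwartz flat_off_free_op)

section \<open>Sesquilinearity of the pairing and its symmetry under the algebra\<close>

lemma pairing_commute: "pairing a b v u = cnj (pairing a b u v)"
  unfolding pairing_def integral_cnj by (simp add: mult.commute)

lemma integrable_mult_cnj:
  "continuous_on {a..b} u \<Longrightarrow> continuous_on {a..b} v \<Longrightarrow>
    (\<lambda>x::real. u x * cnj (v x :: complex)) integrable_on {a..b}"
  by (intro integrable_continuous_interval continuous_intros)

lemma pairing_add_left:
  assumes "continuous_on {a..b} u" "continuous_on {a..b} u'" "continuous_on {a..b} v"
  shows "pairing a b (\<lambda>x. u x + u' x) v = pairing a b u v + pairing a b u' v"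
  unfolding pairing_def distrib_right by (intro integral_add integrable_mult_cnj assms)

lemma pairing_cmult_left: "pairing a b (\<lambda>x. c * u x) v = c * pairing a b u v"
  by (simp add: pairing_def mult.assoc)

lemma pairing_add_right:
  assumes "continuous_on {a..b} u" "continuous_on {a..b} v" "continuous_on {a..b} v'"
  shows "pairing a b u (\<lambda>x. v x + v' x) = pairing a b u v + pairing a b u v'"
  using pairing_add_left[OF assms(2,3,1)] by (simp add: pairing_commute[of a b u])

lemma pairing_cmult_right: "pairing a b u (\<lambda>x. c * v x) = cnj c * pairing a b u v"
  by (simp add: pairing_commute[of a b u] pairing_cmult_left)

lemma pairing_zero_left [simp]: "pairing a b (\<lambda>x. 0) v = 0"
  and pairing_zero_right [simp]: "pairing a b u (\<lambda>x. 0) = 0"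
  by (simp_all add: pairing_def)

definition energy :: "real \<Rightarrow> real \<Rightarrow> (real \<Rightarrow> complex) \<Rightarrow> real"
  where "energy a b u = integral {a..b} (\<lambda>x. (cmod (u x))\<^sup>2)"

lemma pairing_self:
  assumes "continuous_on {a..b} u"
  shows "pairing a b u u = of_real (energy a b u)"
proof -
  have "(\<lambda>x. (cmod (u x))\<^sup>2) integrable_on {a..b}"
    using assms by (intro integrable_continuous_interval continuous_intros)
  then have "((\<lambda>x. of_real ((cmod (u x))\<^sup>2)) has_integral (of_real (energy a b u) :: complex)) {a..b}"
    unfolding energy_def by (intro has_integral_of_real integrable_integral)
  then show ?thesis
    unfolding pairing_def complex_norm_square by (rule integral_unique)
qed

lemma energy_nonneg: "0 \<le> energy a b u"
  \<comment> \<open>Nothing is assumed on \<open>u\<close>; a function that is not integrable has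
    integral zero by convention.\<close>
  unfolding energy_def by (cases "(\<lambda>x. (cmod (u x))\<^sup>2) integrable_on {a..b}")
    (auto intro: integral_nonneg simp: not_integrable_integral)

text \<open>For \<open>p\<close> this is integration by parts. At an endpoint off
  \<open>U \<inter> W\<close> at least one of \<open>u\<close>, \<open>v\<close> vanishes, so there
  is no boundary term; the factor \<open>-\<i>\<close> turns the skew symmetry of the derivative
  into symmetry.\<close>

lemma pairing_gen_op:
  assumes u: "u \<in> flat_off U" and v: "v \<in> flat_off W" and ab: "a \<notin> U \<inter> W" "b \<notin> U \<inter> W"
  shows "pairing a b (gen_op g u) v = pairing a b u (gen_op g v)"
proof (cases g)
  case Gen_q
  then show ?thesis by (simp add: pairing_def mult_ac)
next
  case Gen_p
  show ?thesis
  proof (cases "a \<le> b")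
    case True
    note su = flat_off_smooth[OF u] and sv = flat_off_smooth[OF v]
    have zero: "u t * cnj (v t) = 0" if "t \<notin> U \<inter> W" for t
      using flat_off_zero[OF u] flat_off_zero[OF v] that by auto
    have "((\<lambda>x. u x * cnj (v x)) has_vector_derivative u x * cnj (vderiv v x) + vderiv u x * cnj (v x))
        (at x within {a..b})" for x
      using smooth_has_vderiv[OF su, of 0 x] smooth_has_vderiv[OF sv, of 0 x]
      by (intro has_vector_derivative_mult has_vector_derivative_cnj)
        (auto intro: has_vector_derivative_at_within)
    then have "((\<lambda>x. u x * cnj (vderiv v x) + vderiv u x * cnj (v x)) has_integral 0) {a..b}"
      using fundamental_theorem_of_calculus[OF True, of "\<lambda>x. u x * cnj (v x)"
          "\<lambda>x. u x * cnj (vderiv v x) + vderiv u x * cnj (v x)"]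
      by (simp only: zero[OF ab(1)] zero[OF ab(2)] atLeastAtMost_iff) simp
    moreover have cont: "continuous_on {a..b} (vderiv u)" "continuous_on {a..b} (vderiv v)"
      using smooth_continuous_on[OF smooth_vderiv] su sv by blast+
    have "((\<lambda>x. u x * cnj (vderiv v x) + vderiv u x * cnj (v x)) has_integral
        (pairing a b u (vderiv v) + pairing a b (vderiv u) v)) {a..b}"
      unfolding pairing_def
      by (intro has_integral_add integrable_integral integrable_mult_cnj cont
          smooth_continuous_on[OF su] smooth_continuous_on[OF sv])
    ultimately have "pairing a b u (vderiv v) + pairing a b (vderiv u) v = 0"
      by (rule has_integral_unique[symmetric])
    then have "pairing a b u (vderiv v) = - pairing a b (vderiv u) v"
      by (rule eq_neg_iff_add_eq_0[THEN iffD2])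
    then show ?thesis
      using pairing_cmult_left[of a b "-\<i>" "vderiv u" v] pairing_cmult_right[of a b u "-\<i>" "vderiv v"]
      by (simp add: Gen_p)
  qed (simp add: pairing_def)
qed

lemma pairing_word_op:
  assumes "a \<notin> U \<inter> W" "b \<notin> U \<inter> W"
  shows "u \<in> flat_off U \<Longrightarrow> v \<in> flat_off W \<Longrightarrow>
    pairing a b (word_op w u) v = pairing a b u (word_op (word_rev w) v)"
proof (induction w)
  case (Word gs)
  then show ?case
  \<comment> \<open>The outermost letter is moved first and lands on \<open>v\<close>, hence the
    generalisation over \<open>v\<close>. It ends up innermost there, which reverses the
    word.\<close>
  proof (induction gs arbitrary: v)
    case (Cons g gs)
    have "pairing a b (word_op (Word (g # gs)) u) v = pairing a b (word_op (Word gs) u) (gen_op g v)"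
      using Cons.prems by (simp add: word_op_Cons pairing_gen_op[OF _ _ assms] flat_off_word_op)
    also have "\<dots> = pairing a b u (word_op (Word (rev gs)) (gen_op g v))"
      using Cons by (simp add: flat_off_gen_op)
    also have "word_op (Word (rev gs)) (gen_op g v) = word_op (Word (rev (g # gs))) v"
      by (simp add: word_op_def)
    finally show ?case by simp
  qed (simp add: word_op_Nil)
qed

lemma pairing_free_op:
  assumes "a \<notin> U \<inter> W" "b \<notin> U \<inter> W" and u: "u \<in> flat_off U" and v: "v \<in> flat_off W"
  shows "pairing a b (free_op x u) v = pairing a b u (free_op (free_star x) v)"
proof (induction x rule: free_algebra_induct)
  case zero
  then show ?case by (simp add: free_op_zero free_star_zero)
next
  case (single w c)
  then show ?case
    by (simp add: free_op_single free_star_single pairing_cmult_left pairing_cmult_right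
        pairing_word_op[OF assms])
next
  case (add x y)
  have "continuous_on {a..b} (free_op y u)" "continuous_on {a..b} (free_op y v)" for y
    using u v by (auto intro: flat_off_continuous_on flat_off_free_op)
  with add show ?case
    using u v
    by (simp add: free_op_add free_star_add pairing_add_left pairing_add_right
        flat_off_continuous_on[OF u] flat_off_continuous_on[OF v])
qed

text \<open>The *-property holds on each interval separately. It serves for the ordinary inner
  product, on \<open>{-R..R}\<close>, and for the cross terms on the small intervals.\<close>

lemma pairing_schrodinger:
  assumes "a \<notin> U \<inter> W" "b \<notin> U \<inter> W" and u: "u \<in> flat_off U" and v: "v \<in> flat_off W"
  shows "pairing a b (schrodinger x u) v = pairing a b u (schrodinger (star x) v)"
  by (induction x rule: weyl.abs_induct)
    (simp add: star_weyl.abs_eq schrodinger_abs flat_off_schwartz[OF u] flat_off_schwartz[OF v]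
      pairing_free_op[OF assms])

text \<open>The integrand vanishes off \<open>U \<inter> W\<close>, so the integral over the line
  reduces to the interval, where Lebesgue and gauge integrals of a continuous function
  agree.\<close>

lemma L2_inner_eq_pairing:
  assumes u: "u \<in> flat_off U" and v: "v \<in> flat_off W" and sub: "U \<inter> W \<subseteq> {a..b}"
  shows "L2_inner u v = pairing a b u v"
proof -
  have "L2_inner u v = (LINT x:{a..b}|lborel. u x * cnj (v x))"
    unfolding L2_inner_def set_lebesgue_integral_def
    using flat_off_zero[OF u] flat_off_zero[OF v] sub
    by (intro Bochner_Integration.integral_cong refl) (fastforce simp: indicator_def)
  also have "\<dots> = pairing a b u v"
    unfolding pairing_def
    by (intro set_borel_integral_eq_integral borel_integrable_atLeastAtMost')
      (auto intro!: continuous_intros flat_off_continuous_on[OF u] flat_off_continuous_on[OF v])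
  finally show ?thesis .
qed

text \<open>A power of \<open>x\<close> times a derivative of \<open>f\<close> is continuous, hence
  bounded on the compact support, and it vanishes off \<open>U\<close>.\<close>

lemma test_function_flat_off:
  assumes "f \<in> test_functions" and flat: "\<And>n t. t \<notin> U \<Longrightarrow> (vderiv ^^ n) f t = 0"
    and U: "U \<subseteq> {t. f t \<noteq> 0}"
  shows "f \<in> flat_off U"
proof -
  have sm: "smooth f" and c: "compact (closure {x. f x \<noteq> 0})"
    using assms by (auto simp: test_functions_def)
  have "bounded (range (\<lambda>x. of_real x ^ m * (vderiv ^^ n) f x))" for m n
  proof -
    let ?g = "\<lambda>x. of_real x ^ m * (vderiv ^^ n) f x" and ?K = "closure {x. f x \<noteq> 0}"
    have "smooth ((vderiv ^^ n) f)"
      by (induction n) (auto intro: smooth_vderiv sm)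
    then have "compact (?g ` ?K)"
      by (intro compact_continuous_image c continuous_intros smooth_continuous_on)
    then have "bounded (insert 0 (?g ` ?K))"
      by (simp add: compact_imp_bounded)
    moreover have "range ?g \<subseteq> insert 0 (?g ` ?K)"
    proof
      fix y assume "y \<in> range ?g"
      then obtain x where x: "y = ?g x" by blast
      show "y \<in> insert 0 (?g ` ?K)"
      proof (cases "x \<in> U")
        case True
        then have "x \<in> ?K" using U closure_subset by blast
        with x show ?thesis by blast
      next
        case False
        then show ?thesis using x flat by simp
      qed
    qed
    ultimately show ?thesis by (rule bounded_subset)
  qed
  then show ?thesis
    using sm flat by (simp add: flat_off_def schwartz_space_def)
qed

section \<open>Inner product spaces and *-representations\<close>

lemma complex_field_simps [simp]:
  "carrier complex_field = UNIV" "x \<otimes>\<^bsub>complex_field\<^esub> y = x * y"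
  "x \<oplus>\<^bsub>complex_field\<^esub> y = x + y" "\<one>\<^bsub>complex_field\<^esub> = 1" "\<zero>\<^bsub>complex_field\<^esub> = 0"
  by (simp_all add: complex_field_def)

lemma cring_complex_field: "cring complex_field"
proof (rule cringI)
  show "abelian_group complex_field"
    by (rule abelian_groupI) (auto intro: exI[of _ "- x" for x] simp: add.assoc add.commute)
  show "comm_monoid complex_field"
    by (rule comm_monoidI) (auto simp: mult_ac)
qed (auto simp: distrib_right)

context complex_inner_product_space
begin

lemma ip_add_right:
  "\<lbrakk>x \<in> carrier V; y \<in> carrier V; z \<in> carrier V\<rbrakk> \<Longrightarrow> ip z (x \<oplus>\<^bsub>V\<^esub> y) = ip z x + ip z y"
  by (subst (1 2 3) ip_commute) (auto simp: ip_add_left)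

lemma ip_smult_right:
  "\<lbrakk>x \<in> carrier V; y \<in> carrier V\<rbrakk> \<Longrightarrow> ip y (c \<odot>\<^bsub>V\<^esub> x) = cnj c * ip y x"
  by (subst (1 2) ip_commute) (auto simp: ip_smult_left)

lemma ip_self_real: "x \<in> carrier V \<Longrightarrow> ip x x = of_real (Re (ip x x))"
  using ip_commute[of x x] by (simp add: complex_eq_iff)

lemma Cauchy_Schwarz:
  assumes x: "x \<in> carrier V" and y: "y \<in> carrier V"
  shows "(cmod (ip x y))\<^sup>2 \<le> Re (ip x x) * Re (ip y y)"
proof (cases "ip y y = 0")
  case True
  then have "y = 0 \<odot>\<^bsub>V\<^esub> y" using ip_self_eq_zero[OF y] smult_l_null[of y] y by simp
  then have "ip x y = 0" using ip_smult_right[OF y x, of 0] by simp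
  then show ?thesis using True by simp
next
  case False
  define Y where "Y = Re (ip y y)"
  have yy: "ip y y = of_real Y" unfolding Y_def by (rule ip_self_real[OF y])
  have Y: "Y > 0"
    using False ip_self_nonneg[OF y] by (simp add: yy order_less_le)
  \<comment> \<open>This \<open>c\<close> makes \<open>x + c y\<close> orthogonal to
    \<open>y\<close>; the inequality is the nonnegativity of the square norm of that vector.\<close>
  define c where "c = - ip x y / of_real Y"
  let ?z = "x \<oplus>\<^bsub>V\<^esub> c \<odot>\<^bsub>V\<^esub> y"
  have n: "ip x y * cnj (ip x y) = of_real (cmod (ip x y)) * of_real (cmod (ip x y))"
    by (simp flip: complex_norm_square power2_eq_square)
  have "ip ?z ?z = ip x x + cnj c * ip x y + c * ip y x + c * cnj c * ip y y"
    using x y by (simp add: ip_add_left ip_add_right ip_smult_left ip_smult_right algebra_simps)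
  also have "\<dots> = ip x x - of_real ((cmod (ip x y))\<^sup>2 / Y)"
    using Y by (simp add: ip_commute[OF x y] c_def yy n field_simps power2_eq_square)
  finally have "Re (ip x x) - (cmod (ip x y))\<^sup>2 / Y \<ge> 0"
    using ip_self_nonneg[of ?z] x y by simp
  then show ?thesis
    using Y by (simp add: field_simps Y_def)
qed

end

text \<open>The square norm of \<open>\<pi> a x\<close> is the same in every representation, namely
  \<open>f (star a * a)\<close>, because \<open>a\<close> can be moved across the inner product.
  Cauchy-Schwarz does the rest.\<close>

lemma (in star_representation) representing_bound:
  assumes x: "x \<in> representing_vectors V ip \<pi> f" and y: "y \<in> representing_vectors V ip \<pi> g"
  shows "(cmod (ip (\<pi> a x) (\<pi> b y)))\<^sup>2 \<le> Re (f (star a * a)) * Re (g (star b * b))"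
proof -
  have *: "ip (\<pi> c z) (\<pi> c z) = h (star c * c)" if "z \<in> representing_vectors V ip \<pi> h" for c z h
    using that rep_star[of "\<pi> c z" z "star c"]
    by (auto simp: representing_vectors_def rep_closed rep_mult star_star rep_star)
  show ?thesis
    using Cauchy_Schwarz[of "\<pi> a x" "\<pi> b y"] x y
    by (simp add: *[OF x] *[OF y]) (simp add: representing_vectors_def rep_closed)
qed

section \<open>Transport of representations into the given type\<close>

lemma star_representation_transport:
  fixes V :: "(complex, 'w) module" and e :: "'w \<Rightarrow> 'v"
  assumes rep: "star_representation V ip \<pi>" and e: "inj_on e (carrier V)"
    and d: "\<And>x. x \<in> carrier V \<Longrightarrow> d (e x) = x"
  shows "star_representation
    \<lparr>carrier = e ` carrier V, monoid.mult = (\<lambda>x y. x), one = e \<zero>\<^bsub>V\<^esub>, zero = e \<zero>\<^bsub>V\<^esub>,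
      add = (\<lambda>x y. e (d x \<oplus>\<^bsub>V\<^esub> d y)), smult = (\<lambda>c x. e (c \<odot>\<^bsub>V\<^esub> d x))\<rparr>
    (\<lambda>x y. ip (d x) (d y)) (\<lambda>a x. e (\<pi> a (d x)))" (is "star_representation ?V ?ip ?\<pi>")
proof -
  interpret star_representation V ip \<pi> by (rule rep)
  have grp: "abelian_group ?V"
  proof (rule abelian_groupI)
    fix x assume "x \<in> carrier ?V"
    then obtain x' where "x' \<in> carrier V" "x = e x'" by auto
    then show "\<exists>y\<in>carrier ?V. y \<oplus>\<^bsub>?V\<^esub> x = \<zero>\<^bsub>?V\<^esub>"
      by (intro bexI[of _ "e (\<ominus>\<^bsub>V\<^esub> x')"]) (auto simp: d M.l_neg)
  qed (auto simp: d M.a_ac)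
  have "module complex_field ?V"
    by (rule moduleI[OF cring_complex_field grp])
      (use smult_l_distr smult_r_distr smult_assoc1 smult_one in \<open>auto simp: d\<close>)
  moreover have "complex_inner_product_space_axioms ?V ?ip"
    by standard (auto simp: d ip_add_left ip_smult_left ip_self_nonneg intro: ip_commute
        dest: ip_self_eq_zero)
  moreover have "star_representation_axioms ?V ?ip ?\<pi>"
    by standard (auto simp: d rep_closed rep_linear_add rep_linear_smult rep_add rep_cscale
        rep_mult rep_one rep_star)
  ultimately show ?thesis
    by (simp add: star_representation_def complex_inner_product_space_def)
qed

text \<open>The supremum only sees carriers inside \<open>'v\<close>. A representation on another
  type contributes as soon as its carrier injects into \<open>'v\<close>.\<close>

lemma transition_probability_member:
  fixes V :: "(complex, 'w) module" and e :: "'w \<Rightarrow> 'v"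
  assumes rep: "star_representation V ip \<pi>" and e: "inj_on e (carrier V)"
    and x: "x \<in> representing_vectors V ip \<pi> f" and y: "y \<in> representing_vectors V ip \<pi> g"
  shows "(cmod (ip x y))\<^sup>2 \<in> {(cmod (ip x y))\<^sup>2 | (V :: (complex, 'v) module) ip \<pi> x y.
      star_representation V ip \<pi> \<and>
      x \<in> representing_vectors V ip \<pi> f \<and> y \<in> representing_vectors V ip \<pi> g}"
proof -
  interpret star_representation V ip \<pi> by (rule rep)
  define d where "d = inv_into (carrier V) e"
  have d: "d (e x) = x" if "x \<in> carrier V" for x
    using that e by (simp add: d_def)
  let ?V = "\<lparr>carrier = e ` carrier V, monoid.mult = (\<lambda>x y. x), one = e \<zero>\<^bsub>V\<^esub>, zero = e \<zero>\<^bsub>V\<^esub>,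
      add = (\<lambda>x y. e (d x \<oplus>\<^bsub>V\<^esub> d y)), smult = (\<lambda>c x. e (c \<odot>\<^bsub>V\<^esub> d x))\<rparr>"
  let ?ip = "\<lambda>x y. ip (d x) (d y)" and ?\<pi> = "\<lambda>a x. e (\<pi> a (d x))"
  have "star_representation ?V ?ip ?\<pi>"
    by (rule star_representation_transport[OF rep e d])
  moreover have "e x \<in> representing_vectors ?V ?ip ?\<pi> f" "e y \<in> representing_vectors ?V ?ip ?\<pi> g"
    using x y by (auto simp: representing_vectors_def d rep_closed)
  moreover have "(cmod (ip x y))\<^sup>2 = (cmod (?ip (e x) (e y)))\<^sup>2"
    using x y by (simp add: d representing_vectors_def)
  ultimately show ?thesis
    by (intro CollectI exI[of _ ?V] exI[of _ ?ip] exI[of _ ?\<pi>] exI[of _ "e x"] exI[of _ "e y"] conjI)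
qed

text \<open>A continuous function is determined by its values at rationals, and these by the
  rationals above their real and imaginary parts. Hence a pair of functions is coded by a set of
  natural numbers. This is why a type containing the reals is large enough for the representation
  built below.\<close>

lemma continuous_functions_lepoll_reals:
  "{f :: real \<Rightarrow> complex. continuous_on UNIV f} \<times> {f :: real \<Rightarrow> complex. continuous_on UNIV f}
    \<lesssim> (UNIV :: real set)"
proof -
  let ?C = "{f :: real \<Rightarrow> complex. continuous_on UNIV f}"
  define E :: "(real \<Rightarrow> complex) \<Rightarrow> (rat \<times> rat \<times> bool) set"
    where "E f = {(p, q, i). (if i then Re (f (of_rat p)) else Im (f (of_rat p))) < of_rat q}" for f
  have less: "x \<le> y" if "\<And>q. x < real_of_rat q \<longleftrightarrow> y < of_rat q" for x y
  proof (rule ccontr)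
    assume "\<not> x \<le> y"
    then obtain q where "y < of_rat q" "of_rat q < x" using of_rat_dense[of y x] by auto
    then show False using that[of q] by simp
  qed
  have "f = g" if f: "f \<in> ?C" and g: "g \<in> ?C" and E: "E f = E g" for f g
  proof -
    have iff: "(p, q, i) \<in> E f \<longleftrightarrow> (p, q, i) \<in> E g" for p q i by (simp add: E)
    have "f (of_rat p) = g (of_rat p)" for p
    proof (rule complex_eqI)
      show "Re (f (of_rat p)) = Re (g (of_rat p))"
        using iff[of p _ True] by (intro antisym less) (simp_all add: E_def)
      show "Im (f (of_rat p)) = Im (g (of_rat p))"
        using iff[of p _ False] by (intro antisym less) (simp_all add: E_def)
    qed
    then have "\<And>x. x \<in> \<rat> \<Longrightarrow> f x - g x = 0" by (auto elim!: Rats_cases)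
    moreover have "continuous_on (closure \<rat>) (\<lambda>x. f x - g x)"
      using f g by (auto simp: Rats_closure_real intro!: continuous_on_diff)
    ultimately have "f x - g x = 0" for x
      using continuous_constant_on_closure[of \<rat> "\<lambda>x. f x - g x" 0 x]
      by (simp add: Rats_closure_real)
    then show ?thesis by (auto simp: fun_eq_iff)
  qed
  then have inj: "inj_on E ?C" by (rule inj_onI)
  define F where "F = (\<lambda>(f, g). to_nat ` ((\<lambda>w. (True, w)) ` E f \<union> (\<lambda>w. (False, w)) ` E g))"
  have "inj_on F (?C \<times> ?C)"
  proof (rule inj_onI, clarify)
    fix f g f' g' assume C: "continuous_on UNIV f" "continuous_on UNIV g" "continuous_on UNIV f'" "continuous_on UNIV g'"
      and F: "F (f, g) = F (f', g')"
    have S: "(\<lambda>w. (True, w)) ` E f \<union> (\<lambda>w. (False, w)) ` E g = (\<lambda>w. (True, w)) ` E f' \<union> (\<lambda>w. (False, w)) ` E g'"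
      by (rule inj_image_eq_iff[OF inj_to_nat, THEN iffD1]) (use F in \<open>simp only: F_def prod.case\<close>)
    have "E f = E f'" using arg_cong[OF S, of "\<lambda>X. {w. (True, w) \<in> X}"] by (simp add: image_iff)
    moreover have "E g = E g'" using arg_cong[OF S, of "\<lambda>X. {w. (False, w) \<in> X}"] by (simp add: image_iff)
    ultimately show "f = f' \<and> g = g'" using inj C by (auto dest: inj_onD)
  qed
  then have "?C \<times> ?C \<lesssim> (UNIV :: nat set set)"
    unfolding lepoll_def by blast
  then show ?thesis
    using lepoll_trans nat_sets_eqpoll_reals eqpoll_imp_lepoll by blast
qed

section \<open>Gluing two Schroedinger representations\<close>

lemma schrodinger_add_right:
  assumes "u \<in> schwartz_space" "v \<in> schwartz_space"
  shows "schrodinger x (\<lambda>t. u t + v t) = (\<lambda>t. schrodinger x u t + schrodinger x v t)"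
  using assms
  by (induction x rule: weyl.abs_induct)
    (simp add: schrodinger_abs schwartz_space_add free_op_add_right schwartz_space_smooth)

lemma schrodinger_cmult_right:
  assumes "u \<in> schwartz_space"
  shows "schrodinger x (\<lambda>t. c * u t) = (\<lambda>t. c * schrodinger x u t)"
  using assms
  by (induction x rule: weyl.abs_induct)
    (simp add: schrodinger_abs schwartz_space_cmult free_op_cmult_right schwartz_space_smooth)

lemma schrodinger_zero_right: "schrodinger x (\<lambda>t. 0) = (\<lambda>t. 0)"
  using schrodinger_cmult_right[OF flat_off_schwartz[OF flat_off_zero_fun], of x 0] by simp

text \<open>Closed intervals with disjoint interiors meet at most in endpoints, a null set. Empty
  and one-point intervals are allowed, since they can occur among the intersections used
  later.\<close>

lemma sum_integral_disjoint_le: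
  fixes h :: "real \<Rightarrow> real"
  assumes "finite I" and disj: "disjoint_family_on (\<lambda>i. {a i<..<b i}) I"
    and sub: "\<And>i. i \<in> I \<Longrightarrow> {a i..b i} \<subseteq> {c..d}"
    and h: "continuous_on {c..d} h" "\<And>x. x \<in> {c..d} \<Longrightarrow> 0 \<le> h x"
  shows "(\<Sum>i\<in>I. integral {a i..b i} h) \<le> integral {c..d} h"
proof -
  have int: "h integrable_on {a i..b i}" if "i \<in> I" for i
    using continuous_on_subset[OF h(1) sub[OF that]] by (rule integrable_continuous_interval)
  have "negligible ({a i..b i} \<inter> {a j..b j})" if "i \<in> I" "j \<in> I" "i \<noteq> j" for i j
  proof (rule negligible_subset)
    show "{a i..b i} \<inter> {a j..b j} \<subseteq> {a i, b i, a j, b j}"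
      using disj that by (fastforce simp: disjoint_family_on_def)
    show "negligible {a i, b i, a j, b j}"
      by (simp add: negligible_finite)
  qed
  then have "(h has_integral (\<Sum>i\<in>I. integral {a i..b i} h)) (\<Union>i\<in>I. {a i..b i})"
    by (intro has_integral_UN assms(1) integrable_integral int) (auto simp: pairwise_def)
  moreover have "(h has_integral integral {c..d} h) {c..d}"
    by (intro integrable_integral integrable_continuous_interval h)
  moreover have "(\<Union>i\<in>I. {a i..b i}) \<subseteq> {c..d}"
    by (intro UN_least sub)
  ultimately show ?thesis
    using h(2) by (intro has_integral_subset_le[of "\<Union>i\<in>I. {a i..b i}" "{c..d}" h]) auto
qed

text \<open>An index \<open>i\<close> will be a pair of interval numbers,
  \<open>{a i<..<b i}\<close> the intersection of the two intervals and \<open>\<tau> i\<close> the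
  coefficient of its cross term. A common bound \<open>\<rho> < 1\<close> gives definiteness, and
  \<open>ends\<close> removes the boundary terms.\<close>

locale glued_pair =
  fixes U W :: "real set" and R :: real and I :: "'i set" and a b :: "'i \<Rightarrow> real"
    and \<tau> :: "'i \<Rightarrow> complex" and \<rho> :: real
  assumes R_pos: "0 < R" and U_sub: "U \<subseteq> {-R<..<R}" and W_sub: "W \<subseteq> {-R<..<R}"
    and fin: "finite I"
    and ends: "\<And>i. i \<in> I \<Longrightarrow> a i \<notin> U \<inter> W" "\<And>i. i \<in> I \<Longrightarrow> b i \<notin> U \<inter> W"
    and sub: "\<And>i. i \<in> I \<Longrightarrow> {a i..b i} \<subseteq> {-R..R}"
    and disj: "disjoint_family_on (\<lambda>i. {a i<..<b i}) I"
    and \<tau>_le: "\<And>i. i \<in> I \<Longrightarrow> cmod (\<tau> i) \<le> \<rho>"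
    and \<rho>: "0 \<le> \<rho>" "\<rho> < 1"
begin

definition cross :: "(real \<Rightarrow> complex) \<Rightarrow> (real \<Rightarrow> complex) \<Rightarrow> complex"
  where "cross u v = (\<Sum>i\<in>I. \<tau> i * pairing (a i) (b i) u v)"

definition pair_space :: "(complex, (real \<Rightarrow> complex) \<times> (real \<Rightarrow> complex)) module"
  where "pair_space = \<lparr>carrier = flat_off U \<times> flat_off W, monoid.mult = (\<lambda>z w. z),
    one = (\<lambda>t. 0, \<lambda>t. 0), zero = (\<lambda>t. 0, \<lambda>t. 0),
    add = (\<lambda>z w. (\<lambda>t. fst z t + fst w t, \<lambda>t. snd z t + snd w t)),
    smult = (\<lambda>c z. (\<lambda>t. c * fst z t, \<lambda>t. c * snd z t))\<rparr>"

text \<open>The last summand is the conjugate of the preceding one with the arguments exchanged,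
  which makes the form hermitian.\<close>

definition pair_ip ::
  "(real \<Rightarrow> complex) \<times> (real \<Rightarrow> complex) \<Rightarrow> (real \<Rightarrow> complex) \<times> (real \<Rightarrow> complex) \<Rightarrow> complex"
  where "pair_ip z w = pairing (-R) R (fst z) (fst w) + pairing (-R) R (snd z) (snd w) +
    cross (fst z) (snd w) + cnj (cross (fst w) (snd z))"

definition pair_rep ::
  "weyl \<Rightarrow> (real \<Rightarrow> complex) \<times> (real \<Rightarrow> complex) \<Rightarrow> (real \<Rightarrow> complex) \<times> (real \<Rightarrow> complex)"
  where "pair_rep x z = (schrodinger x (fst z), schrodinger x (snd z))"

lemma cross_add:
  assumes "smooth u" "smooth u'" "smooth v"
  shows "cross (\<lambda>t. u t + u' t) v = cross u v + cross u' v"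
    and "cross v (\<lambda>t. u t + u' t) = cross v u + cross v u'"
  using assms
  by (simp_all add: cross_def pairing_add_left pairing_add_right smooth_continuous_on
      distrib_left sum.distrib)

lemma cross_cmult:
  "cross (\<lambda>t. c * u t) v = c * cross u v" "cross u (\<lambda>t. c * v t) = cnj c * cross u v"
  by (simp_all add: cross_def pairing_cmult_left pairing_cmult_right sum_distrib_left mult_ac)

lemma cross_zero [simp]: "cross (\<lambda>t. 0) v = 0" "cross u (\<lambda>t. 0) = 0"
  by (simp_all add: cross_def)

lemma cross_schrodinger:
  "u \<in> flat_off U \<Longrightarrow> v \<in> flat_off W \<Longrightarrow>
    cross (schrodinger x u) v = cross u (schrodinger (star x) v)"
  unfolding cross_def
  by (intro sum.cong refl arg_cong2[where f = "(*)"] pairing_schrodinger[where U = U and W = W] ends)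

text \<open>Pointwise, a product is at most the mean of the squares. As the intervals do not
  overlap, their integrals add up to at most the integral over \<open>{-R..R}\<close>, so that
  \<open>\<rho>\<close> enters only once, however many intervals there are.\<close>

lemma cross_bound:
  assumes u: "smooth u" and v: "smooth v"
  shows "cmod (cross u v) \<le> \<rho> * (energy (-R) R u + energy (-R) R v) / 2"
proof -
  let ?h = "\<lambda>x. ((cmod (u x))\<^sup>2 + (cmod (v x))\<^sup>2) / 2"
  note [continuous_intros] = smooth_continuous_on[OF u] smooth_continuous_on[OF v]
  have "cmod (pairing c d u v) \<le> integral {c..d} ?h" for c d
    unfolding pairing_def
  proof (rule integral_norm_bound_integral)
    show "(\<lambda>x. u x * cnj (v x)) integrable_on {c..d}" "?h integrable_on {c..d}"
      by (auto intro!: integrable_continuous_interval continuous_intros)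
    show "cmod (u x * cnj (v x)) \<le> ?h x" for x
      using sum_squares_bound[of "cmod (u x)" "cmod (v x)"] by (simp add: norm_mult)
  qed
  then have "cmod (\<tau> i * pairing (a i) (b i) u v) \<le> \<rho> * integral {a i..b i} ?h" if "i \<in> I" for i
    unfolding norm_mult using that by (intro mult_mono \<tau>_le \<rho>) auto
  then have "cmod (cross u v) \<le> (\<Sum>i\<in>I. \<rho> * integral {a i..b i} ?h)"
    unfolding cross_def by (rule sum_norm_le)
  also have "\<dots> \<le> \<rho> * integral {-R..R} ?h"
    unfolding sum_distrib_left[symmetric]
    by (intro mult_left_mono \<rho> sum_integral_disjoint_le fin disj sub)
      (auto intro!: continuous_intros)
  also have "integral {-R..R} ?h = (energy (-R) R u + energy (-R) R v) / 2"
    unfolding energy_def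
    by (subst Henstock_Kurzweil_Integration.integral_add[symmetric])
      (auto intro!: integrable_continuous_interval continuous_intros)
  finally show ?thesis by simp
qed

lemma energy_eq_zero:
  assumes "u \<in> flat_off X" "X \<subseteq> {-R<..<R}" and "energy (-R) R u = 0"
  shows "u = (\<lambda>t. 0)"
proof (rule ext)
  fix t
  show "u t = 0"
  proof (cases "t \<in> {-R..R}")
    case True
    have c: "continuous_on (cbox (-R) R) (\<lambda>x. (cmod (u x))\<^sup>2)"
      using flat_off_continuous_on[OF assms(1)] by (auto intro!: continuous_intros)
    then have "((\<lambda>x. (cmod (u x))\<^sup>2) has_integral 0) (cbox (-R) R)"
      using integrable_integral[OF integrable_continuous[OF c]] assms(3) by (simp add: energy_def)
    from has_integral_0_cbox_imp_0[OF c _ this, of t] show ?thesis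
      using True R_pos by auto
  next
    case False
    then have "t \<notin> X" using assms(2) by auto
    then show ?thesis by (rule flat_off_zero[OF assms(1)])
  qed
qed

text \<open>On the diagonal the cross terms add up to twice a real part, which cancels the factor
  1/2 in \<open>cross_bound\<close>. Definiteness follows as \<open>\<rho> < 1\<close>.\<close>

lemma pair_ip_self:
  assumes "fst z \<in> flat_off U" "snd z \<in> flat_off W"
  shows "(1 - \<rho>) * (energy (-R) R (fst z) + energy (-R) R (snd z)) \<le> Re (pair_ip z z)"
  using cross_bound[of "fst z" "snd z"] assms abs_Re_le_cmod[of "cross (fst z) (snd z)"]
  by (simp add: pair_ip_def pairing_self flat_off_continuous_on[OF assms(1)]
      flat_off_continuous_on[OF assms(2)] flat_off_smooth algebra_simps)

lemma pair_star_representation: "star_representation pair_space pair_ip pair_rep"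
proof -
  note flat = flat_off_smooth flat_off_schwartz flat_off_add flat_off_cmult flat_off_zero_fun
    flat_off_schrodinger
  have grp: "abelian_group pair_space"
  proof (rule abelian_groupI)
    fix z assume "z \<in> carrier pair_space"
    then show "\<exists>w\<in>carrier pair_space. w \<oplus>\<^bsub>pair_space\<^esub> z = \<zero>\<^bsub>pair_space\<^esub>"
      using flat_off_cmult[of "fst z" U "-1"] flat_off_cmult[of "snd z" W "-1"]
      by (intro bexI[of _ "(\<lambda>t. - fst z t, \<lambda>t. - snd z t)"]) (auto simp: pair_space_def)
  qed (auto simp: pair_space_def flat add_ac)
  have "module complex_field pair_space"
    by (rule moduleI[OF cring_complex_field grp]) (auto simp: pair_space_def flat algebra_simps)
  moreover have "complex_inner_product_space_axioms pair_space pair_ip"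
  proof
    fix x y z c
    assume xyz: "x \<in> carrier pair_space" "y \<in> carrier pair_space" "z \<in> carrier pair_space"
    have cont: "continuous_on {-R..R} (fst w)" "continuous_on {-R..R} (snd w)"
      "smooth (fst w)" "smooth (snd w)" if "w \<in> carrier pair_space" for w
      using that by (auto simp: pair_space_def flat_off_smooth smooth_continuous_on)
    show "pair_ip (x \<oplus>\<^bsub>pair_space\<^esub> y) z = pair_ip x z + pair_ip y z"
      using cont[OF xyz(1)] cont[OF xyz(2)] cont[OF xyz(3)]
      by (simp add: pair_space_def pair_ip_def pairing_add_left cross_add)
  next
    fix x y c
    show "pair_ip (c \<odot>\<^bsub>pair_space\<^esub> x) y = c * pair_ip x y"
      by (simp add: pair_space_def pair_ip_def pairing_cmult_left cross_cmult algebra_simps)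
    show "pair_ip y x = cnj (pair_ip x y)"
      by (simp add: pair_ip_def pairing_commute[symmetric])
  next
    fix x assume x: "x \<in> carrier pair_space"
    then have bound: "(1 - \<rho>) * (energy (-R) R (fst x) + energy (-R) R (snd x)) \<le> Re (pair_ip x x)"
      by (intro pair_ip_self) (auto simp: pair_space_def)
    moreover have "0 \<le> (1 - \<rho>) * (energy (-R) R (fst x) + energy (-R) R (snd x))"
      using \<rho> energy_nonneg by simp
    ultimately show "0 \<le> Re (pair_ip x x)" by simp
    assume "pair_ip x x = 0"
    then have "energy (-R) R (fst x) + energy (-R) R (snd x) \<le> 0"
      using bound \<rho> by (simp add: mult_le_0_iff)
    then have "energy (-R) R (fst x) = 0" "energy (-R) R (snd x) = 0"
      using energy_nonneg[of "-R" R "fst x"] energy_nonneg[of "-R" R "snd x"] by linarith+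
    then show "x = \<zero>\<^bsub>pair_space\<^esub>"
      using x energy_eq_zero[OF _ U_sub] energy_eq_zero[OF _ W_sub]
      by (auto simp: pair_space_def prod_eq_iff)
  qed
  moreover have "star_representation_axioms pair_space pair_ip pair_rep"
  proof
    fix x y a assume xy: "x \<in> carrier pair_space" "y \<in> carrier pair_space"
    have "- R \<notin> U \<inter> U" "R \<notin> U \<inter> U" "- R \<notin> W \<inter> W" "R \<notin> W \<inter> W"
      using U_sub W_sub by auto
    then show "pair_ip (pair_rep a x) y = pair_ip x (pair_rep (star a) y)"
      \<comment> \<open>In the conjugated cross term the algebra element acts on the second
        argument, so symmetry is used there for \<open>star a\<close>.\<close>
      using xy pairing_schrodinger[of "-R" U U R] pairing_schrodinger[of "-R" W W R]
        cross_schrodinger[of "fst x" "snd y" a] cross_schrodinger[of "fst y" "snd x" "star a"]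
      by (auto simp: pair_ip_def pair_rep_def pair_space_def star_star)
  qed (auto simp: pair_space_def pair_rep_def flat schrodinger_add schrodinger_cscale
      schrodinger_mult schrodinger_one schrodinger_add_right schrodinger_cmult_right)
  ultimately show ?thesis
    by (simp add: star_representation_def complex_inner_product_space_def)
qed

text \<open>Both cross terms vanish between vectors of the first summand, so the coupling does not
  change the functional defined by \<open>f\<close>.\<close>

lemma representing_fst:
  assumes "f \<in> flat_off U"
  shows "(f, \<lambda>t. 0) \<in> representing_vectors pair_space pair_ip pair_rep (vector_functional f)"
proof -
  have "L2_inner (schrodinger x f) f = pairing (-R) R (schrodinger x f) f" for x
    by (rule L2_inner_eq_pairing) (use assms U_sub in \<open>auto intro: flat_off_schrodinger\<close>)
  then show ?thesis
    using assms by (auto simp: representing_vectors_def pair_space_def pair_ip_def pair_rep_def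
        vector_functional_def schrodinger_zero_right flat_off_zero_fun)
qed

lemma representing_snd:
  assumes "g \<in> flat_off W"
  shows "(\<lambda>t. 0, g) \<in> representing_vectors pair_space pair_ip pair_rep (vector_functional g)"
proof -
  have "L2_inner (schrodinger x g) g = pairing (-R) R (schrodinger x g) g" for x
    by (rule L2_inner_eq_pairing) (use assms W_sub in \<open>auto intro: flat_off_schrodinger\<close>)
  then show ?thesis
    using assms by (auto simp: representing_vectors_def pair_space_def pair_ip_def pair_rep_def
        vector_functional_def schrodinger_zero_right flat_off_zero_fun)
qed

lemma pair_space_embedding:
  assumes "\<exists>h :: real \<Rightarrow> 'v. inj h"
  shows "\<exists>e :: _ \<Rightarrow> 'v. inj_on e (carrier pair_space)"
proof -
  obtain h :: "real \<Rightarrow> 'v" where h: "inj h" using assms by blast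
  obtain k :: "(real \<Rightarrow> complex) \<times> (real \<Rightarrow> complex) \<Rightarrow> real"
    where k: "inj_on k ({f. continuous_on UNIV f} \<times> {f. continuous_on UNIV f})"
    using continuous_functions_lepoll_reals unfolding lepoll_def by blast
  have "carrier pair_space \<subseteq> {f. continuous_on UNIV f} \<times> {f. continuous_on UNIV f}"
    by (auto simp: pair_space_def intro: flat_off_continuous_on)
  then have "inj_on (h \<circ> k) (carrier pair_space)"
    by (intro comp_inj_on inj_on_subset[OF k] inj_on_subset[OF h]) auto
  then show ?thesis by blast
qed

lemma cross_mem:
  fixes f g
  assumes "\<exists>h :: real \<Rightarrow> 'v. inj h" and "f \<in> flat_off U" "g \<in> flat_off W"
  shows "(cmod (cross f g))\<^sup>2 \<in> {(cmod (ip x y))\<^sup>2 | (V :: (complex, 'v) module) ip \<pi> x y.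
      star_representation V ip \<pi> \<and>
      x \<in> representing_vectors V ip \<pi> (vector_functional f) \<and>
      y \<in> representing_vectors V ip \<pi> (vector_functional g)}"
proof -
  obtain e :: "_ \<Rightarrow> 'v" where e: "inj_on e (carrier pair_space)"
    using pair_space_embedding[OF assms(1)] by blast
  \<comment> \<open>The vectors lie in different summands, so only a cross term is left.\<close>
  have "pair_ip (f, \<lambda>t. 0) (\<lambda>t. 0, g) = cross f g"
    by (simp add: pair_ip_def)
  then show ?thesis
    using transition_probability_member[OF pair_star_representation e
        representing_fst[OF assms(2)] representing_snd[OF assms(3)]] by simp
qed

end

section \<open>Polynomials in the position generator\<close>

lemma cscale_zero_left: "0 *\<^sub>C (a::'a::complex_star_algebra) = 0"
  using cscale_add_left[of 0 0 a] by simp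

lemma cscale_zero_right: "c *\<^sub>C (0::'a::complex_star_algebra) = 0"
  using cscale_add_right[of c 0 "0::'a"] by simp

lemma star_zero: "star (0::'a::complex_star_algebra) = 0"
  using star_add[of 0 "0::'a"] by simp

lemma star_one: "star (1::'a::complex_star_algebra) = 1"
  by (metis mult.left_neutral mult.right_neutral star_mult star_star)

text \<open>The value of the polynomial at \<open>weyl_q\<close>, in Horner form, which gives a
  recursion along \<open>pCons\<close>.\<close>

definition qpoly :: "complex poly \<Rightarrow> weyl"
  where "qpoly P = fold_coeffs (\<lambda>c r. c *\<^sub>C 1 + weyl_q * r) P 0"

lemma qpoly_0 [simp]: "qpoly 0 = 0"
  by (simp add: qpoly_def)

lemma qpoly_pCons [simp]: "qpoly (pCons c P) = c *\<^sub>C 1 + weyl_q * qpoly P"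
  by (cases "c = 0 \<and> P = 0") (auto simp: qpoly_def cscale_zero_left)

lemma qpoly_1 [simp]: "qpoly 1 = 1"
  by (simp add: one_pCons cscale_one)

lemma qpoly_add: "qpoly (P + Q) = qpoly P + qpoly Q"
  by (induction P Q rule: poly_induct2) (simp_all add: cscale_add_left algebra_simps)

lemma qpoly_smult: "qpoly (Polynomial.smult c P) = c *\<^sub>C qpoly P"
  by (induction P)
    (simp_all add: cscale_zero_right cscale_add_right cscale_cscale cscale_mult_right)

lemma qpoly_mult: "qpoly (P * Q) = qpoly P * qpoly Q"
  by (induction P)
    (simp_all add: qpoly_add qpoly_smult cscale_zero_left cscale_mult_left distrib_right mult.assoc)

lemma qpoly_commute: "qpoly P * qpoly Q = qpoly Q * qpoly P"
  by (simp add: mult.commute flip: qpoly_mult)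

lemma star_qpoly: "star (qpoly P) = qpoly (map_poly cnj P)"
proof (induction P)
  case (pCons c P)
  have "weyl_q * qpoly Q = qpoly Q * weyl_q" for Q
    using qpoly_commute[of "[:0, 1:]" Q] by (simp add: cscale_zero_left cscale_one)
  with pCons show ?case
    by (simp add: map_poly_pCons star_add star_cscale star_one star_mult star_weyl_q)
qed (simp add: star_zero)

text \<open>The commutator with \<open>p\<close> is a derivation and takes \<open>q\<close> to
  \<open>-\<i>\<close>; the product rule then yields the derivative by induction along Horner's
  scheme.\<close>

lemma weyl_p_qpoly:
  "weyl_p * qpoly P = qpoly P * weyl_p + (- \<i>) *\<^sub>C qpoly (pderiv P)"
proof (induction P)
  case (pCons c P)
  have i: "- (\<i> *\<^sub>C a) = (- \<i>) *\<^sub>C a" for a :: weyl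
    using cscale_add_left[of \<i> "-\<i>" a] by (simp add: cscale_zero_left minus_unique)
  have pq: "weyl_p * weyl_q = weyl_q * weyl_p + (- \<i>) *\<^sub>C 1"
    using weyl_relation by (simp add: i algebra_simps)
  have "weyl_p * (weyl_q * qpoly P) = (weyl_p * weyl_q) * qpoly P"
    by (simp only: mult.assoc)
  also have "\<dots> = weyl_q * (weyl_p * qpoly P) + (- \<i>) *\<^sub>C qpoly P"
    by (simp add: pq distrib_right cscale_mult_left mult.assoc)
  finally show ?case
    by (simp add: pCons pderiv_pCons qpoly_add distrib_left distrib_right cscale_mult_left
        cscale_mult_right cscale_add_right cscale_zero_left mult.assoc add_ac)
qed (simp add: cscale_zero_right)

lemma schrodinger_qpoly:
  assumes f: "f \<in> schwartz_space"
  shows "schrodinger (qpoly P) f = (\<lambda>t. poly P (of_real t) * f t)"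
proof (induction P)
  case 0
  show ?case using schrodinger_cscale[OF f, of 0 0] by (simp add: cscale_zero_left)
next
  case (pCons c P)
  have "(\<lambda>t. poly P (of_real t) * f t) \<in> schwartz_space"
    using schrodinger_closed[OF f, of "qpoly P"] by (simp add: pCons)
  then show ?case
    using f by (simp add: schrodinger_add schrodinger_cscale schrodinger_one schrodinger_mult
        schrodinger_q pCons algebra_simps)
qed

lemma poly_map_cnj: "poly (map_poly cnj P) (of_real t) = cnj (poly P (of_real t))"
  by (induction P) (simp_all add: map_poly_pCons)

section \<open>The functional on polynomials given by a pair of representing vectors\<close>

abbreviation nrm :: "real \<Rightarrow> (real \<Rightarrow> complex) \<Rightarrow> real"
  where "nrm R u \<equiv> sqrt (energy (- R) R u)"

text \<open>The setting of the upper bound: an arbitrary *-representation with arbitrary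
  representing vectors, tied to \<phi> and \<psi> only through the two functionals.\<close>

locale representing_pair = star_representation V ip \<pi>
  for V :: "(complex, 'v) module" and ip and \<pi> :: "weyl \<Rightarrow> 'v \<Rightarrow> 'v" +
  fixes \<phi> \<psi> :: "real \<Rightarrow> complex" and U W :: "real set" and R :: real and x y :: 'v
  assumes \<phi>: "\<phi> \<in> flat_off U" and \<psi>: "\<psi> \<in> flat_off W"
    and U_sub: "U \<subseteq> {-R<..<R}" and W_sub: "W \<subseteq> {-R<..<R}"
    and x: "x \<in> representing_vectors V ip \<pi> (vector_functional \<phi>)"
    and y: "y \<in> representing_vectors V ip \<pi> (vector_functional \<psi>)"
begin

lemma vector_functional_star_mult:
  assumes "\<eta> \<in> flat_off X" "X \<subseteq> {-R<..<R}"
  shows "Re (vector_functional \<eta> (star a * a)) = energy (-R) R (schrodinger a \<eta>)"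
proof -
  have "vector_functional \<eta> (star a * a) =
      pairing (-R) R (schrodinger (star a) (schrodinger a \<eta>)) \<eta>"
    unfolding vector_functional_def schrodinger_mult[OF flat_off_schwartz[OF assms(1)]]
    by (rule L2_inner_eq_pairing) (use assms in \<open>auto intro: flat_off_schrodinger\<close>)
  also have "pairing (-R) R (schrodinger (star a) (schrodinger a \<eta>)) \<eta> =
      pairing (-R) R (schrodinger a \<eta>) (schrodinger a \<eta>)"
  proof -
    have "-R \<notin> X \<inter> X" "R \<notin> X \<inter> X" using assms(2) by auto
    from pairing_schrodinger[OF this, of "schrodinger a \<eta>" \<eta> "star a"] show ?thesis
      using assms(1) by (simp add: flat_off_schrodinger star_star)
  qed
  also have "\<dots> = energy (-R) R (schrodinger a \<eta>)"
    by (rule pairing_self) (use assms in \<open>auto intro: flat_off_continuous_on flat_off_schrodinger\<close>)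
  finally show ?thesis by simp
qed

lemma x_carrier: "x \<in> carrier V" and y_carrier: "y \<in> carrier V"
  using x y by (auto simp: representing_vectors_def)

text \<open>Both norms on the right belong to the Schroedinger representation, so estimates in an
  unknown space become estimates of integrals.\<close>

lemma form_bound:
  "cmod (ip (\<pi> a x) (\<pi> b y)) \<le> nrm R (schrodinger a \<phi>) * nrm R (schrodinger b \<psi>)"
proof -
  have "(cmod (ip (\<pi> a x) (\<pi> b y)))\<^sup>2 \<le>
      energy (-R) R (schrodinger a \<phi>) * energy (-R) R (schrodinger b \<psi>)"
    using representing_bound[OF x y, of a b] \<phi> \<psi> U_sub W_sub
    by (simp add: vector_functional_star_mult)
  then show ?thesis
    by (metis real_le_rsqrt real_sqrt_mult)
qed

definition L :: "complex poly \<Rightarrow> complex"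
  where "L P = ip (\<pi> (qpoly P) x) y"

lemma L_add: "L (P + Q) = L P + L Q"
  by (simp add: L_def qpoly_add rep_add rep_closed ip_add_left x_carrier y_carrier)

lemma L_smult: "L (Polynomial.smult c P) = c * L P"
  by (simp add: L_def qpoly_smult rep_cscale rep_closed ip_smult_left x_carrier y_carrier)

text \<open>Since \<open>q\<close> is hermitian, the factors of a product can be distributed over
  the two vectors. The coefficients of \<open>Q\<close> get conjugated on the way, which does not
  affect the norm.\<close>

lemma L_mult_bound:
  "cmod (L (P * Q)) \<le> nrm R (\<lambda>t. poly P (of_real t) * \<phi> t) * nrm R (\<lambda>t. poly Q (of_real t) * \<psi> t)"
proof -
  have "L (P * Q) = ip (\<pi> (qpoly Q) (\<pi> (qpoly P) x)) y"
    by (simp add: L_def qpoly_mult qpoly_commute[of P] rep_mult x_carrier)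
  also have "\<dots> = ip (\<pi> (qpoly P) x) (\<pi> (qpoly (map_poly cnj Q)) y)"
    by (simp add: rep_star rep_closed x_carrier y_carrier star_qpoly)
  also have "cmod \<dots> \<le> nrm R (schrodinger (qpoly P) \<phi>) * nrm R (schrodinger (qpoly (map_poly cnj Q)) \<psi>)"
    by (rule form_bound)
  finally show ?thesis
    by (simp add: schrodinger_qpoly flat_off_schwartz[OF \<phi>] flat_off_schwartz[OF \<psi>] poly_map_cnj
        energy_def norm_mult)
qed

text \<open>
  For \<open>A \<approx> P \<phi>' / \<phi>\<close> and \<open>B \<approx> P cnj (\<psi>' / \<psi>)\<close> the bound is small, so that \<open>L\<close> almost annihilates
  \<open>(P \<phi> cnj \<psi>)' / (\<phi> cnj \<psi>)\<close>.  It stems from moving \<open>p\<close> across the inner product.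
\<close>

lemma L_deriv_bound:
  "cmod (L (pderiv P) + L A + L B) \<le>
    nrm R (\<lambda>t. poly P (of_real t) * vderiv \<phi> t - poly A (of_real t) * \<phi> t) * nrm R \<psi> +
    nrm R \<phi> * nrm R (\<lambda>t. poly P (of_real t) * cnj (vderiv \<psi> t) - poly B (of_real t) * cnj (\<psi> t))"
proof -
  note c = x_carrier y_carrier
  note s = flat_off_schwartz[OF \<phi>] flat_off_schwartz[OF \<psi>]
  let ?P = "map_poly cnj P" and ?B = "map_poly cnj B"
  \<comment> \<open>In the Schroedinger representation the two operators give
    \<open>-\<i> * (P * \<phi>' - A * \<phi>)\<close> and
    \<open>-\<i> * cnj (P * cnj \<psi>' - B * cnj \<psi>)\<close>. The factor \<open>\<pi> 1\<close>
    is there to match \<open>form_bound\<close>.\<close>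
  define e1 where "e1 = ip (\<pi> (qpoly P * weyl_p + \<i> *\<^sub>C qpoly A) x) (\<pi> 1 y)"
  define e2 where "e2 = ip (\<pi> 1 x) (\<pi> (qpoly ?P * weyl_p + \<i> *\<^sub>C qpoly ?B) y)"
  have "ip (\<pi> (weyl_p * qpoly P) x) y = ip (\<pi> (qpoly P) x) (\<pi> weyl_p y)"
    by (simp add: rep_mult rep_star rep_closed c star_weyl_p)
  also have "\<dots> = ip x (\<pi> (qpoly ?P * weyl_p) y)"
    by (simp add: rep_mult rep_star rep_closed c star_qpoly)
  finally have eq: "ip (\<pi> (weyl_p * qpoly P) x) y = ip x (\<pi> (qpoly ?P * weyl_p) y)" .
  have B: "ip x (\<pi> (qpoly ?B) y) = L B"
    using rep_star[of x y "qpoly B"] by (simp add: c L_def star_qpoly)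
  have 1: "e1 = ip (\<pi> (weyl_p * qpoly P) x) y + \<i> * L (pderiv P) + \<i> * L A"
    by (simp add: e1_def weyl_p_qpoly L_def c rep_closed rep_add rep_cscale rep_one ip_add_left
        ip_smult_left)
  have 2: "e2 = ip x (\<pi> (qpoly ?P * weyl_p) y) - \<i> * L B"
    by (simp add: e2_def c rep_closed rep_add rep_cscale rep_one ip_add_right ip_smult_right B)
  \<comment> \<open>The terms with \<open>p\<close> cancel by \<open>eq\<close>, which rests on the
    hermiticity of \<open>p\<close>; the commutator leaves \<open>L (pderiv P)\<close>.\<close>
  have "e1 - e2 = \<i> * (L (pderiv P) + L A + L B)"
    by (simp add: 1 2 eq algebra_simps)
  then have "cmod (L (pderiv P) + L A + L B) = cmod (e1 - e2)"
    by (simp add: norm_mult)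
  also have "\<dots> \<le> cmod e1 + cmod e2"
    by (rule norm_triangle_ineq4)
  also have "cmod e1 \<le> nrm R (\<lambda>t. poly P (of_real t) * vderiv \<phi> t - poly A (of_real t) * \<phi> t) * nrm R \<psi>"
  proof -
    have "schrodinger (qpoly P * weyl_p + \<i> *\<^sub>C qpoly A) \<phi> =
        (\<lambda>t. - \<i> * (poly P (of_real t) * vderiv \<phi> t - poly A (of_real t) * \<phi> t))"
      using s schrodinger_closed[OF s(1), of weyl_p]
      by (simp add: schrodinger_add schrodinger_cscale schrodinger_mult schrodinger_qpoly
          schrodinger_p algebra_simps)
    then show ?thesis
      unfolding e1_def using form_bound[of "qpoly P * weyl_p + \<i> *\<^sub>C qpoly A" 1]
      by (simp add: schrodinger_one s energy_def norm_mult)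
  qed
  also have "cmod e2 \<le> nrm R \<phi> *
      nrm R (\<lambda>t. poly P (of_real t) * cnj (vderiv \<psi> t) - poly B (of_real t) * cnj (\<psi> t))"
  proof -
    have "schrodinger (qpoly ?P * weyl_p + \<i> *\<^sub>C qpoly ?B) \<psi> =
        (\<lambda>t. - \<i> * cnj (poly P (of_real t) * cnj (vderiv \<psi> t) - poly B (of_real t) * cnj (\<psi> t)))"
      using s schrodinger_closed[OF s(2), of weyl_p]
      by (simp add: schrodinger_add schrodinger_cscale schrodinger_mult schrodinger_qpoly
          schrodinger_p poly_map_cnj algebra_simps)
    then show ?thesis
      unfolding e2_def using form_bound[of 1 "qpoly ?P * weyl_p + \<i> *\<^sub>C qpoly ?B"]
      by (simp add: schrodinger_one s energy_def norm_mult del: complex_cnj_diff complex_cnj_mult)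
  qed
  finally show ?thesis by simp
qed

end

section \<open>Uniform approximation by polynomials\<close>

abbreviation rpoly :: "complex poly \<Rightarrow> real \<Rightarrow> complex"
  where "rpoly P \<equiv> \<lambda>t. poly P (of_real t)"

lemma has_vector_derivative_rpoly:
  "(rpoly P has_vector_derivative rpoly (pderiv P) t) (at t within S)"
  by (rule has_vector_derivative_real_field) (rule poly_DERIV)

lemma Weierstrass_rpoly:
  assumes g: "continuous_on {a..b} g" and e: "0 < e"
  shows "\<exists>P. \<forall>t\<in>{a..b}. cmod (g t - rpoly P t) < e"
proof -
  obtain h where h: "polynomial_function h" "\<And>t. t \<in> {a..b} \<Longrightarrow> cmod (g t - h t) < e"
    using Stone_Weierstrass_polynomial_function[OF compact_Icc g e] by blast
  have sum: "\<exists>P. \<forall>t. of_real (p t) = rpoly P t" if p: "real_polynomial_function p" for p :: "real \<Rightarrow> real"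
  proof -
    obtain c n where "p = (\<lambda>x. \<Sum>i\<le>n. c i * x ^ i)"
      using real_polynomial_function_imp_sum[OF p] by blast
    then show ?thesis
      by (intro exI[of _ "\<Sum>i\<le>n. monom (of_real (c i)) i"]) (simp add: poly_sum poly_monom)
  qed
  have "real_polynomial_function (Re \<circ> h)" "real_polynomial_function (Im \<circ> h)"
    using h(1) bounded_linear_Re bounded_linear_Im unfolding polynomial_function_def by blast+
  then obtain P Q where PQ: "\<And>t. of_real (Re (h t)) = rpoly P t" "\<And>t. of_real (Im (h t)) = rpoly Q t"
    using sum[of "Re \<circ> h"] sum[of "Im \<circ> h"] by auto
  have "h t = rpoly (P + Polynomial.smult \<i> Q) t" for t
    using complex_eq[of "h t"] by (simp flip: PQ)
  then show ?thesis using h(2) by metis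
qed

lemma uniform_limit_rpoly:
  assumes "continuous_on {a..b} g"
  shows "\<exists>P. uniform_limit {a..b} (\<lambda>n. rpoly (P n)) g sequentially"
proof -
  have "\<exists>P. \<forall>t\<in>{a..b}. cmod (g t - rpoly P t) < inverse (real (Suc n))" for n
    by (rule Weierstrass_rpoly[OF assms]) simp
  then obtain P where P: "\<And>n t. t \<in> {a..b} \<Longrightarrow> cmod (g t - rpoly (P n) t) < inverse (real (Suc n))"
    by metis
  have "uniform_limit {a..b} (\<lambda>n. rpoly (P n)) g sequentially"
  proof (rule uniform_limitI)
    fix e :: real assume "0 < e"
    then have "\<forall>\<^sub>F n in sequentially. inverse (real (Suc n)) < e"
      by (rule order_tendstoD(2)[OF LIMSEQ_inverse_real_of_nat])
    then show "\<forall>\<^sub>F n in sequentially. \<forall>t\<in>{a..b}. dist (rpoly (P n) t) (g t) < e"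
      by eventually_elim (auto simp: dist_norm norm_minus_commute intro: less_trans[OF P])
  qed
  then show ?thesis by blast
qed

lemma pderiv_sum: "pderiv (\<Sum>i\<in>I. f i) = (\<Sum>i\<in>I. pderiv (f i))"
  by (induction I rule: infinite_finite_induct) (simp_all add: pderiv_add)

lemma antiderivative_poly:
  fixes P :: "complex poly"
  obtains Q where "pderiv Q = P" "poly Q z = c"
proof
  let ?Q = "\<Sum>i\<le>degree P. monom (coeff P i / of_nat (Suc i)) (Suc i)"
  show "pderiv (?Q + [:c - poly ?Q z:]) = P"
    by (simp add: pderiv_add pderiv_sum pderiv_monom pderiv_pCons poly_as_sum_of_monoms
        del: of_nat_Suc)
  show "poly (?Q + [:c - poly ?Q z:]) z = c" by simp
qed

text \<open>The derivative is approximated first and then integrated from \<open>a\<close>, as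
  uniform closeness of functions says nothing about their derivatives.\<close>

lemma uniform_limit_rpoly_C1:
  assumes ab: "a \<le> b" and g': "continuous_on {a..b} g'"
    and g: "\<And>t. t \<in> {a..b} \<Longrightarrow> (g has_vector_derivative g' t) (at t within {a..b})"
  shows "\<exists>P. uniform_limit {a..b} (\<lambda>n. rpoly (pderiv (P n))) g' sequentially \<and>
    uniform_limit {a..b} (\<lambda>n. rpoly (P n)) g sequentially"
proof -
  obtain D where D: "uniform_limit {a..b} (\<lambda>n. rpoly (D n)) g' sequentially"
    using uniform_limit_rpoly[OF g'] by blast
  have "\<exists>Q. pderiv Q = D n \<and> rpoly Q a = g a" for n
    by (meson antiderivative_poly)
  then obtain P where P: "\<And>n. pderiv (P n) = D n" "\<And>n. rpoly (P n) a = g a"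
    by metis
  have "uniform_limit {a..b} (\<lambda>n. rpoly (P n)) g sequentially"
  proof (rule uniform_limitI)
    fix e :: real assume e: "0 < e"
    \<comment> \<open>The summand 1 covers \<open>a = b\<close> and makes the bound
      \<open>e' * (b - a)\<close> strictly smaller than \<open>e\<close>.\<close>
    define e' where "e' = e / (b - a + 1)"
    have e': "0 < e'" "e' * (b - a) < e"
      using e ab by (auto simp: e'_def field_simps)
    have "\<forall>\<^sub>F n in sequentially. \<forall>t\<in>{a..b}. dist (rpoly (D n) t) (g' t) < e'"
      using uniform_limitD[OF D e'(1)] .
    then show "\<forall>\<^sub>F n in sequentially. \<forall>t\<in>{a..b}. dist (rpoly (P n) t) (g t) < e"
    proof eventually_elim
      case (elim n)
      show ?case
      proof
        fix t assume t: "t \<in> {a..b}"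
        have I: "((\<lambda>s. rpoly (D n) s - g' s) has_integral
            (rpoly (P n) t - g t) - (rpoly (P n) a - g a)) {a..t}"
        proof (rule fundamental_theorem_of_calculus)
          show "((\<lambda>s. rpoly (P n) s - g s) has_vector_derivative rpoly (D n) s - g' s)
              (at s within {a..t})" if "s \<in> {a..t}" for s
            using has_vector_derivative_rpoly[of "P n" s] g[of s] that t
            by (intro has_vector_derivative_diff)
              (auto simp: P intro: has_vector_derivative_within_subset)
        qed (use t in auto)
        have "cmod ((rpoly (P n) t - g t) - (rpoly (P n) a - g a)) \<le> e' * measure lborel {a..t}"
          by (rule has_integral_bound_real[OF _ finite.emptyI I])
            (use e' elim t in \<open>auto simp: dist_norm less_imp_le\<close>)
        also have "\<dots> \<le> e' * (b - a)"
          using t e' by (intro mult_left_mono) auto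
        finally show "dist (rpoly (P n) t) (g t) < e"
          using e'(2) by (simp add: P dist_norm)
      qed
    qed
  qed
  with D show ?thesis by (intro exI[of _ P]) (simp add: P(1))
qed

section \<open>Norms under uniform limits\<close>

lemma bounded_continuous_image_Icc:
  fixes u :: "real \<Rightarrow> 'a::real_normed_vector"
  shows "continuous_on {a..b} u \<Longrightarrow> bounded (u ` {a..b})"
  by (intro compact_imp_bounded compact_continuous_image compact_Icc)

lemma nrm_uniform_limit:
  assumes u: "uniform_limit {-R..R} u v sequentially" and c: "\<And>n. continuous_on {-R..R} (u n)"
  shows "(\<lambda>n. nrm R (u n)) \<longlonglongrightarrow> nrm R v"
proof -
  have v: "continuous_on {-R..R} v"
    by (rule uniform_limit_theorem[OF _ u]) (auto simp: c)
  have "uniform_limit {-R..R} (\<lambda>n t. cmod (u n t) * cmod (u n t)) (\<lambda>t. cmod (v t) * cmod (v t)) sequentially"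
    by (intro uniform_lim_mult uniform_limit_norm u bounded_continuous_image_Icc continuous_intros v)
  then have "(\<lambda>n. energy (-R) R (u n)) \<longlonglongrightarrow> energy (-R) R v"
  proof (rule uniform_limit_integral)
    fix I J assume I: "\<And>n. ((\<lambda>t. cmod (u n t) * cmod (u n t)) has_integral I n) {-R..R}"
      and J: "((\<lambda>t. cmod (v t) * cmod (v t)) has_integral J) {-R..R}" and "I \<longlonglongrightarrow> J"
    then show ?thesis
      unfolding energy_def power2_eq_square integral_unique[OF I] integral_unique[OF J] by simp
  qed (auto intro!: continuous_intros c)
  then show ?thesis by (rule tendsto_real_sqrt)
qed

lemma nrm_zero [simp]: "nrm R (\<lambda>t. 0) = 0"
  by (simp add: energy_def)

lemma nrm_mono:
  assumes "continuous_on {-R..R} u" "continuous_on {-R..R} v"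
    and "\<And>t. t \<in> {-R..R} \<Longrightarrow> cmod (u t) \<le> cmod (v t)"
  shows "nrm R u \<le> nrm R v"
  unfolding energy_def using assms
  by (intro real_sqrt_le_mono integral_le)
    (auto intro!: integrable_continuous_interval continuous_intros power_mono)

lemma nrm_cmult: "nrm R (\<lambda>t. c * u t) = cmod c * nrm R u"
  by (simp add: energy_def norm_mult power_mult_distrib real_sqrt_mult)

lemma nrm_nonneg: "0 \<le> nrm R u"
  by (simp add: energy_nonneg)

section \<open>Extension to continuous functions\<close>

text \<open>From here on the representation is forgotten: the formula for \<open>L 1\<close> is
  derived from these properties of \<open>L\<close> alone.\<close>

locale local_functional =
  fixes \<phi> \<psi> :: "real \<Rightarrow> complex" and R :: real and L :: "complex poly \<Rightarrow> complex"
  assumes R_pos: "0 < R" and smooth_\<phi>: "smooth \<phi>" and smooth_\<psi>: "smooth \<psi>"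
    and L_add: "\<And>P Q. L (P + Q) = L P + L Q"
    and L_smult: "\<And>c P. L (Polynomial.smult c P) = c * L P"
    and L_mult_bound: "\<And>P Q. cmod (L (P * Q)) \<le>
      nrm R (\<lambda>t. rpoly P t * \<phi> t) * nrm R (\<lambda>t. rpoly Q t * \<psi> t)"
    and L_deriv_bound: "\<And>P A B. cmod (L (pderiv P) + L A + L B) \<le>
      nrm R (\<lambda>t. rpoly P t * vderiv \<phi> t - rpoly A t * \<phi> t) * nrm R \<psi> +
      nrm R \<phi> * nrm R (\<lambda>t. rpoly P t * cnj (vderiv \<psi> t) - rpoly B t * cnj (\<psi> t))"
begin

lemma cont [continuous_intros]:
  "continuous_on S \<phi>" "continuous_on S \<psi>" "continuous_on S (vderiv \<phi>)" "continuous_on S (vderiv \<psi>)"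
  by (intro smooth_continuous_on smooth_vderiv smooth_\<phi> smooth_\<psi>)+

lemma L_diff: "L (P - Q) = L P - L Q"
  using L_add[of "P - Q" Q] by simp

text \<open>The case \<open>Q = 1\<close> of \<open>L_mult_bound\<close>. It makes \<open>L\<close>
  continuous in the uniform norm, hence extendable.\<close>

lemma L_bound:
  assumes "\<And>t. t \<in> {-R..R} \<Longrightarrow> cmod (rpoly P t) \<le> B"
  shows "cmod (L P) \<le> B * (nrm R \<phi> * nrm R \<psi>)"
proof -
  have B: "0 \<le> B"
    using assms[of 0] R_pos by (auto intro: order_trans[OF norm_ge_zero])
  have "cmod (L P) \<le> nrm R (\<lambda>t. rpoly P t * \<phi> t) * nrm R \<psi>"
    using L_mult_bound[of P 1] by simp
  also have "\<dots> \<le> nrm R (\<lambda>t. of_real B * \<phi> t) * nrm R \<psi>"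
    using B by (intro mult_right_mono[OF nrm_mono nrm_nonneg])
      (auto intro!: continuous_intros mult_right_mono assms simp: norm_mult)
  finally show ?thesis
    using B by (simp add: nrm_cmult mult.assoc)
qed

text \<open>The extension of \<open>L\<close> by continuity, as the common limit along all
  approximating sequences. If no polynomial sequence converges to \<open>g\<close>, the value is
  arbitrary.\<close>

definition Hat :: "(real \<Rightarrow> complex) \<Rightarrow> complex"
  where "Hat g = (SOME z. \<forall>P. uniform_limit {-R..R} (\<lambda>n. rpoly (P n)) g sequentially \<longrightarrow>
    (\<lambda>n. L (P n)) \<longlonglongrightarrow> z)"

lemma Hat_limit:
  assumes P: "uniform_limit {-R..R} (\<lambda>n. rpoly (P n)) g sequentially"
  shows "(\<lambda>n. L (P n)) \<longlonglongrightarrow> Hat g"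
proof -
  let ?C = "nrm R \<phi> * nrm R \<psi>"
  have C: "0 \<le> ?C" by (intro mult_nonneg_nonneg nrm_nonneg)
  \<comment> \<open>For \<open>Q = P\<close> this is the Cauchy property; for general
    \<open>Q\<close> it shows that the limit does not depend on the sequence.\<close>
  have close: "\<exists>N. \<forall>m\<ge>N. \<forall>n\<ge>N. cmod (L (P m) - L (Q n)) < e"
    if Q: "uniform_limit {-R..R} (\<lambda>n. rpoly (Q n)) g sequentially" and e: "0 < e" for Q e
  proof -
    define d where "d = e / (2 * (?C + 1))"
    have d: "0 < d" and dC: "2 * d * ?C < e"
      using C e by (simp_all add: d_def field_simps)
    obtain N1 where N1: "\<And>n t. n \<ge> N1 \<Longrightarrow> t \<in> {-R..R} \<Longrightarrow> dist (rpoly (P n) t) (g t) < d"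
      using P d unfolding uniform_limit_sequentially_iff by blast
    obtain N2 where N2: "\<And>n t. n \<ge> N2 \<Longrightarrow> t \<in> {-R..R} \<Longrightarrow> dist (rpoly (Q n) t) (g t) < d"
      using Q d unfolding uniform_limit_sequentially_iff by blast
    have "cmod (L (P m) - L (Q n)) < e" if "m \<ge> max N1 N2" "n \<ge> max N1 N2" for m n
    proof -
      have "cmod (rpoly (P m - Q n) t) \<le> 2 * d" if "t \<in> {-R..R}" for t
      proof -
        have "dist (rpoly (P m) t) (rpoly (Q n) t) \<le> dist (rpoly (P m) t) (g t) + dist (rpoly (Q n) t) (g t)"
          by (rule dist_triangle2)
        then show ?thesis
          using N1[of m t] N2[of n t] that \<open>m \<ge> _\<close> \<open>n \<ge> _\<close> by (simp add: dist_norm)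
      qed
      then have "cmod (L (P m - Q n)) \<le> 2 * d * ?C" by (rule L_bound)
      then show ?thesis using dC by (simp add: L_diff)
    qed
    then show ?thesis by blast
  qed
  have "Cauchy (\<lambda>n. L (P n))"
    by (rule CauchyI) (use close[OF P] in blast)
  then obtain z where z: "(\<lambda>n. L (P n)) \<longlonglongrightarrow> z"
    using Cauchy_convergent convergent_def by blast
  have "(\<lambda>n. L (Q n)) \<longlonglongrightarrow> z"
    if Q: "uniform_limit {-R..R} (\<lambda>n. rpoly (Q n)) g sequentially" for Q
  proof -
    have "(\<lambda>n. L (P n) - L (Q n)) \<longlonglongrightarrow> 0"
      unfolding LIMSEQ_iff using close[OF Q] by force
    from tendsto_diff[OF z this] show ?thesis by simp
  qed
  then have "\<forall>Q. uniform_limit {-R..R} (\<lambda>n. rpoly (Q n)) g sequentially \<longrightarrow> (\<lambda>n. L (Q n)) \<longlonglongrightarrow> z"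
    by blast
  then have "\<forall>Q. uniform_limit {-R..R} (\<lambda>n. rpoly (Q n)) g sequentially \<longrightarrow> (\<lambda>n. L (Q n)) \<longlonglongrightarrow> Hat g"
    unfolding Hat_def by (rule someI)
  with P show ?thesis by blast
qed

lemma Hat_rpoly: "Hat (rpoly P) = L P"
  using Hat_limit[of "\<lambda>n. P" "rpoly P"] by (simp add: uniform_limit_const LIMSEQ_const_iff)

lemma Hat_zero [simp]: "Hat (\<lambda>t. 0) = 0"
  using Hat_rpoly[of 0] L_diff[of 0 0] by simp

lemma Hat_one: "Hat (\<lambda>t. 1) = L 1"
  using Hat_rpoly[of 1] by simp

lemma Hat_add:
  assumes "continuous_on {-R..R} g" "continuous_on {-R..R} h"
  shows "Hat (\<lambda>t. g t + h t) = Hat g + Hat h"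
proof -
  obtain P Q where P: "uniform_limit {-R..R} (\<lambda>n. rpoly (P n)) g sequentially"
    and Q: "uniform_limit {-R..R} (\<lambda>n. rpoly (Q n)) h sequentially"
    using assms uniform_limit_rpoly by metis
  have "(\<lambda>n. L (P n + Q n)) \<longlonglongrightarrow> Hat (\<lambda>t. g t + h t)"
    by (rule Hat_limit) (use uniform_limit_add[OF P Q] in simp)
  moreover have "(\<lambda>n. L (P n + Q n)) \<longlonglongrightarrow> Hat g + Hat h"
    unfolding L_add by (intro tendsto_add Hat_limit P Q)
  ultimately show ?thesis by (rule LIMSEQ_unique)
qed

lemma Hat_cmult:
  assumes "continuous_on {-R..R} g"
  shows "Hat (\<lambda>t. c * g t) = c * Hat g"
proof -
  obtain P where P: "uniform_limit {-R..R} (\<lambda>n. rpoly (P n)) g sequentially"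
    using assms uniform_limit_rpoly by metis
  have "(\<lambda>n. L (Polynomial.smult c (P n))) \<longlonglongrightarrow> Hat (\<lambda>t. c * g t)"
    by (rule Hat_limit)
      (use bounded_linear.uniform_limit[OF bounded_linear_mult_right P, of c] in simp)
  moreover have "(\<lambda>n. L (Polynomial.smult c (P n))) \<longlonglongrightarrow> c * Hat g"
    unfolding L_smult by (intro tendsto_mult_left Hat_limit P)
  ultimately show ?thesis by (rule LIMSEQ_unique)
qed

lemma Hat_sum:
  assumes "\<And>i. i \<in> I \<Longrightarrow> continuous_on {-R..R} (g i)"
  shows "Hat (\<lambda>t. \<Sum>i\<in>I. g i t) = (\<Sum>i\<in>I. Hat (g i))"
  using assms
  by (induction I rule: infinite_finite_induct) (simp_all add: Hat_add continuous_on_sum)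

lemma uniform_limit_rpoly_mult:
  assumes P: "uniform_limit {-R..R} (\<lambda>n. rpoly (P n)) g sequentially"
    and "continuous_on {-R..R} g" and "continuous_on {-R..R} h"
  shows "uniform_limit {-R..R} (\<lambda>n t. rpoly (P n) t * h t) (\<lambda>t. g t * h t) sequentially"
  by (intro uniform_lim_mult P uniform_limit_const bounded_continuous_image_Icc assms)

lemma Hat_mult_bound:
  assumes g: "continuous_on {-R..R} g" and h: "continuous_on {-R..R} h"
  shows "cmod (Hat (\<lambda>t. g t * h t)) \<le> nrm R (\<lambda>t. g t * \<phi> t) * nrm R (\<lambda>t. h t * \<psi> t)"
proof -
  obtain P Q where P: "uniform_limit {-R..R} (\<lambda>n. rpoly (P n)) g sequentially"
    and Q: "uniform_limit {-R..R} (\<lambda>n. rpoly (Q n)) h sequentially"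
    using g h uniform_limit_rpoly by metis
  have "uniform_limit {-R..R} (\<lambda>n. rpoly (P n * Q n)) (\<lambda>t. g t * h t) sequentially"
    using uniform_lim_mult[OF P Q bounded_continuous_image_Icc[OF g] bounded_continuous_image_Icc[OF h]]
    by simp
  from tendsto_norm[OF Hat_limit[OF this]]
  have 1: "(\<lambda>n. cmod (L (P n * Q n))) \<longlonglongrightarrow> cmod (Hat (\<lambda>t. g t * h t))" .
  have 2: "(\<lambda>n. nrm R (\<lambda>t. rpoly (P n) t * \<phi> t) * nrm R (\<lambda>t. rpoly (Q n) t * \<psi> t)) \<longlonglongrightarrow>
      nrm R (\<lambda>t. g t * \<phi> t) * nrm R (\<lambda>t. h t * \<psi> t)"
    by (intro tendsto_mult nrm_uniform_limit uniform_limit_rpoly_mult P Q g h continuous_intros)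
  show ?thesis
    by (rule LIMSEQ_le[OF 1 2]) (use L_mult_bound in blast)
qed

text \<open>The functions \<open>a\<close> and \<open>b\<close> stand for
  \<open>g * \<phi>' / \<phi>\<close> and \<open>g * cnj (\<psi>' / \<psi>)\<close>, described
  without division so that zeros of \<phi> and \<psi> do no harm. Approximating \<open>g\<close>
  together with its derivative sends both norms in \<open>L_deriv_bound\<close> to zero.\<close>

lemma Hat_deriv:
  assumes g: "\<And>t. t \<in> {-R..R} \<Longrightarrow> (g has_vector_derivative g' t) (at t within {-R..R})"
    and g': "continuous_on {-R..R} g'" and a: "continuous_on {-R..R} a" and b: "continuous_on {-R..R} b"
    and ga: "\<And>t. t \<in> {-R..R} \<Longrightarrow> g t * vderiv \<phi> t = a t * \<phi> t"
    and gb: "\<And>t. t \<in> {-R..R} \<Longrightarrow> g t * cnj (vderiv \<psi> t) = b t * cnj (\<psi> t)"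
  shows "Hat (\<lambda>t. g' t + a t + b t) = 0"
proof -
  have gc: "continuous_on {-R..R} g"
    using g by (meson continuous_on_vector_derivative)
  obtain P where P': "uniform_limit {-R..R} (\<lambda>n. rpoly (pderiv (P n))) g' sequentially"
    and P: "uniform_limit {-R..R} (\<lambda>n. rpoly (P n)) g sequentially"
    using uniform_limit_rpoly_C1[OF _ g' g] R_pos by auto
  obtain A B where A: "uniform_limit {-R..R} (\<lambda>n. rpoly (A n)) a sequentially"
    and B: "uniform_limit {-R..R} (\<lambda>n. rpoly (B n)) b sequentially"
    using a b uniform_limit_rpoly by metis
  have "(\<lambda>n. nrm R (\<lambda>t. rpoly (P n) t * vderiv \<phi> t - rpoly (A n) t * \<phi> t)) \<longlonglongrightarrow>
      nrm R (\<lambda>t. g t * vderiv \<phi> t - a t * \<phi> t)"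
    by (intro nrm_uniform_limit uniform_limit_minus uniform_limit_rpoly_mult P A gc a continuous_intros)
  also have "nrm R (\<lambda>t. g t * vderiv \<phi> t - a t * \<phi> t) = nrm R (\<lambda>t. 0)"
    unfolding energy_def using ga by (intro arg_cong[where f = sqrt] integral_cong) simp
  finally have 1: "(\<lambda>n. nrm R (\<lambda>t. rpoly (P n) t * vderiv \<phi> t - rpoly (A n) t * \<phi> t)) \<longlonglongrightarrow> 0"
    by simp
  have "(\<lambda>n. nrm R (\<lambda>t. rpoly (P n) t * cnj (vderiv \<psi> t) - rpoly (B n) t * cnj (\<psi> t))) \<longlonglongrightarrow>
      nrm R (\<lambda>t. g t * cnj (vderiv \<psi> t) - b t * cnj (\<psi> t))"
    by (intro nrm_uniform_limit uniform_limit_minus uniform_limit_rpoly_mult P B gc b continuous_intros)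
  also have "nrm R (\<lambda>t. g t * cnj (vderiv \<psi> t) - b t * cnj (\<psi> t)) = nrm R (\<lambda>t. 0)"
    unfolding energy_def using gb by (intro arg_cong[where f = sqrt] integral_cong) simp
  finally have 2: "(\<lambda>n. nrm R (\<lambda>t. rpoly (P n) t * cnj (vderiv \<psi> t) - rpoly (B n) t * cnj (\<psi> t))) \<longlonglongrightarrow> 0"
    by simp
  have "(\<lambda>n. L (pderiv (P n)) + L (A n) + L (B n)) \<longlonglongrightarrow> 0"
  proof (rule Lim_null_comparison)
    show "\<forall>\<^sub>F n in sequentially. cmod (L (pderiv (P n)) + L (A n) + L (B n)) \<le>
        nrm R (\<lambda>t. rpoly (P n) t * vderiv \<phi> t - rpoly (A n) t * \<phi> t) * nrm R \<psi> +
        nrm R \<phi> * nrm R (\<lambda>t. rpoly (P n) t * cnj (vderiv \<psi> t) - rpoly (B n) t * cnj (\<psi> t))"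
      using L_deriv_bound by (intro always_eventually allI)
    show "(\<lambda>n. nrm R (\<lambda>t. rpoly (P n) t * vderiv \<phi> t - rpoly (A n) t * \<phi> t) * nrm R \<psi> +
        nrm R \<phi> * nrm R (\<lambda>t. rpoly (P n) t * cnj (vderiv \<psi> t) - rpoly (B n) t * cnj (\<psi> t))) \<longlonglongrightarrow> 0"
      using tendsto_add[OF tendsto_mult_right[OF 1, of "nrm R \<psi>"] tendsto_mult_left[OF 2, of "nrm R \<phi>"]]
      by simp
  qed
  moreover have "(\<lambda>n. L (pderiv (P n)) + L (A n) + L (B n)) \<longlonglongrightarrow> Hat g' + Hat a + Hat b"
    by (intro tendsto_add Hat_limit P' A B)
  ultimately have "Hat g' + Hat a + Hat b = 0" by (blast intro: LIMSEQ_unique)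
  then show ?thesis by (simp add: Hat_add g' a b continuous_on_add)
qed

end

section \<open>Compactly supported functions and cutoffs\<close>

text \<open>Support in a compact part of the open interval. The set \<open>{c'..d'}\<close> may be
  empty, so the zero function qualifies for all \<open>c\<close> and \<open>d\<close>.\<close>

definition csupp :: "real \<Rightarrow> real \<Rightarrow> (real \<Rightarrow> complex) \<Rightarrow> bool"
  where "csupp c d k \<longleftrightarrow> continuous_on UNIV k \<and> (\<exists>c'>c. \<exists>d'<d. \<forall>t. t \<notin> {c'..d'} \<longrightarrow> k t = 0)"

lemma csupp_continuous_on: "csupp c d k \<Longrightarrow> continuous_on S k"
  unfolding csupp_def using continuous_on_subset by blast

lemma csupp_zero: "csupp c d k \<Longrightarrow> t \<notin> {c<..<d} \<Longrightarrow> k t = 0"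
  unfolding csupp_def by fastforce

text \<open>The factor \<open>m\<close> may blow up at the endpoints, like a reciprocal of \<phi>,
  since \<open>k\<close> vanishes near them. Continuity is glued from two open sets that cover the
  line.\<close>

lemma csupp_mult:
  assumes k: "csupp c d k" and m: "continuous_on {c<..<d} m"
  shows "csupp c d (\<lambda>t. k t * m t)"
proof -
  obtain c' d' where cd: "c < c'" "d' < d" and z: "\<And>t. t \<notin> {c'..d'} \<Longrightarrow> k t = 0"
    using k unfolding csupp_def by blast
  have "continuous_on (-{c'..d'}) (\<lambda>t. k t * m t) \<longleftrightarrow> continuous_on (-{c'..d'}) (\<lambda>t. 0 :: complex)"
    by (rule continuous_on_cong) (use z in auto)
  then have "continuous_on ({c<..<d} \<union> -{c'..d'}) (\<lambda>t. k t * m t)"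
    using k m by (intro continuous_on_open_Un open_Compl)
      (auto intro!: continuous_intros elim: csupp_continuous_on)
  moreover have "{c<..<d} \<union> -{c'..d'} = UNIV" using cd by auto
  ultimately show ?thesis
    unfolding csupp_def using cd z by (metis mult_zero_left)
qed

lemma csupp_inter:
  assumes "csupp c d k" "csupp c' d' k'"
  shows "csupp (max c c') (min d d') (\<lambda>t. k t * k' t)"
proof -
  obtain a b where 1: "c < a" "b < d" "\<And>t. t \<notin> {a..b} \<Longrightarrow> k t = 0"
    using assms unfolding csupp_def by blast
  obtain a' b' where 2: "c' < a'" "b' < d'" "\<And>t. t \<notin> {a'..b'} \<Longrightarrow> k' t = 0"
    using assms unfolding csupp_def by blast
  have "\<forall>t. t \<notin> {max a a'..min b b'} \<longrightarrow> k t * k' t = 0"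
    using 1(3) 2(3) by auto
  moreover have "max c c' < max a a'" "min b b' < min d d'" using 1 2 by auto
  moreover have "continuous_on UNIV (\<lambda>t. k t * k' t)"
    using assms by (intro continuous_intros csupp_continuous_on)
  ultimately show ?thesis unfolding csupp_def by blast
qed

lemma csupp_diff_cmult:
  assumes "csupp c d k" "csupp c d k'"
  shows "csupp c d (\<lambda>t. k t - z * k' t)"
proof -
  obtain a b where 1: "c < a" "b < d" "\<And>t. t \<notin> {a..b} \<Longrightarrow> k t = 0"
    using assms unfolding csupp_def by blast
  obtain a' b' where 2: "c < a'" "b' < d" "\<And>t. t \<notin> {a'..b'} \<Longrightarrow> k' t = 0"
    using assms unfolding csupp_def by blast
  have "k t - z * k' t = 0" if "t \<notin> {min a a'..max b b'}" for t
  proof -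
    have "t \<notin> {a..b}" "t \<notin> {a'..b'}" using that by auto
    then show ?thesis using 1(3) 2(3) by simp
  qed
  moreover have "c < min a a'" "max b b' < d" using 1 2 by auto
  moreover have "continuous_on UNIV (\<lambda>t. k t - z * k' t)"
    using assms by (intro continuous_intros csupp_continuous_on)
  ultimately show ?thesis unfolding csupp_def by blast
qed

lemma csupp_has_vector_derivative_mult:
  assumes k: "csupp c d k" and k': "csupp c d k'"
    and dk: "\<And>t. (k has_vector_derivative k' t) (at t)"
    and dm: "\<And>t. t \<in> {c<..<d} \<Longrightarrow> (m has_vector_derivative m' t) (at t)"
  shows "((\<lambda>t. k t * m t) has_vector_derivative k t * m' t + k' t * m t) (at t)"
proof (cases "t \<in> {c<..<d}")
  case True
  then show ?thesis by (intro has_vector_derivative_mult dk dm)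
next
  case False
  obtain c' d' where cd: "c < c'" "d' < d" and z: "\<And>t. t \<notin> {c'..d'} \<Longrightarrow> k t = 0"
    using k unfolding csupp_def by blast
  \<comment> \<open>Near such a point \<open>k\<close> vanishes identically, whatever
    \<open>m\<close> does there.\<close>
  have "((\<lambda>t. k t * m t) has_vector_derivative 0) (at t)"
    by (rule has_vector_derivative_transform_within_open[of "\<lambda>t. 0" _ _ "-{c'..d'}"])
      (use False cd z in auto)
  then show ?thesis
    using csupp_zero[OF k False] csupp_zero[OF k' False] by simp
qed

text \<open>The integral from \<open>c\<close> vanishes to the left of the support; to the right it
  equals the full integral, which is zero by assumption.\<close>

lemma csupp_antiderivative:
  assumes k: "csupp c d k" and cd: "c < d" and int: "integral {c..d} k = 0"
  shows "\<exists>G. csupp c d G \<and> (\<forall>t. (G has_vector_derivative k t) (at t))"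
proof -
  obtain c' d' where cd': "c < c'" "d' < d" and z: "\<And>t. t \<notin> {c'..d'} \<Longrightarrow> k t = 0"
    using k unfolding csupp_def by blast
  define G where "G t = integral {c..t} k" for t
  have ki: "k integrable_on {a..b}" for a b
    by (rule integrable_continuous_interval) (rule csupp_continuous_on[OF k])
  have left: "G t = 0" if "t < c'" for t
  proof -
    have "integral {c..t} k = integral {c..t} (\<lambda>t. 0)"
      by (rule integral_cong) (use that z in auto)
    then show ?thesis by (simp add: G_def)
  qed
  have right: "G t = 0" if "d' < t" for t
  proof (cases "t < c")
    case False
    have 0: "integral {a..b} k = 0" if "d' < a" for a b
    proof -
      have "integral {a..b} k = integral {a..b} (\<lambda>t. 0)"
        by (rule integral_cong) (use that z in auto)
      then show ?thesis by simp
    qed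
    show ?thesis
    proof (cases "t \<le> d")
      case True
      then have "G t + integral {t..d} k = integral {c..d} k"
        unfolding G_def using False by (intro Henstock_Kurzweil_Integration.integral_combine ki) auto
      then show ?thesis using 0[OF that] int by simp
    next
      case t: False
      then have "integral {c..d} k + integral {d..t} k = G t"
        unfolding G_def using cd by (intro Henstock_Kurzweil_Integration.integral_combine ki) auto
      then show ?thesis using 0[OF cd'(2)] int by simp
    qed
  qed (simp add: G_def)
  have deriv: "(G has_vector_derivative k t) (at t)" for t
  proof (cases "t < c'")
    case True
    have "(G has_vector_derivative 0) (at t)"
      by (rule has_vector_derivative_transform_within_open[of "\<lambda>t. 0" _ _ "{..<c'}"])
        (use True left in auto)
    with True show ?thesis using z[of t] by simp
  next
    case False
    then have t: "t \<in> {c<..<t + 1}" using cd' by auto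
    have "(G has_vector_derivative k t) (at t within {c..t + 1})"
      unfolding G_def using t
      by (intro integral_has_vector_derivative csupp_continuous_on[OF k]) auto
    then have "(G has_vector_derivative k t) (at t within {c<..<t + 1})"
      by (rule has_vector_derivative_within_subset) auto
    then show ?thesis
      using t by (simp add: at_within_open[OF _ open_greaterThanLessThan])
  qed
  have "continuous_on UNIV G"
    by (rule continuous_on_vector_derivative) (use deriv in auto)
  moreover have "\<forall>t. t \<notin> {c'..d'} \<longrightarrow> G t = 0" using left right by auto
  ultimately have "csupp c d G" unfolding csupp_def using cd' by blast
  with deriv show ?thesis by blast
qed

text \<open>A product of two ramps: zero up to distance \<open>1/n\<close> from an endpoint, one
  where both distances are at least \<open>2/n\<close>. The subtracted 1 keeps the support away from
  the endpoints. For \<open>n = 0\<close> the function is constantly zero.\<close>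

definition cut :: "real \<Rightarrow> real \<Rightarrow> nat \<Rightarrow> real \<Rightarrow> real"
  where "cut c d n t = min 1 (max 0 (of_nat n * (t - c) - 1)) * min 1 (max 0 (of_nat n * (d - t) - 1))"

lemma cut_nonneg: "0 \<le> cut c d n t" and cut_le_one: "cut c d n t \<le> 1"
  unfolding cut_def by (auto intro!: mult_le_one)

lemma continuous_on_cut: "continuous_on S (cut c d n)"
  unfolding cut_def by (intro continuous_intros)

lemma cut_eq_zero: "t \<notin> {c<..<d} \<Longrightarrow> cut c d n t = 0"
proof -
  assume "t \<notin> {c<..<d}"
  then have "of_nat n * (t - c) \<le> 0 \<or> of_nat n * (d - t) \<le> 0"
    by (auto intro: mult_nonneg_nonpos)
  then show ?thesis unfolding cut_def by (elim disjE) simp_all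
qed

lemma csupp_cut: "csupp c d (\<lambda>t. of_real (cut c d n t))"
proof (cases "n = 0")
  case True
  then have "cut c d n t = 0" for t by (simp add: cut_def)
  then show ?thesis
    unfolding csupp_def by (intro conjI exI[of _ "c + 1"] exI[of _ "d - 1"]) auto
next
  case False
  have "cut c d n t = 0" if "t \<notin> {c + 1 / n..d - 1 / n}" for t
  proof -
    have "of_nat n * (t - c) < 1 \<or> of_nat n * (d - t) < 1"
      using that False by (auto simp: field_simps)
    then show ?thesis unfolding cut_def by (elim disjE) simp_all
  qed
  then show ?thesis
    unfolding csupp_def using False
    by (intro conjI exI[of _ "c + 1 / n"] exI[of _ "d - 1 / n"])
      (auto intro!: continuous_intros continuous_on_cut)
qed

lemma cut_tendsto:
  assumes "t \<in> {c<..<d}"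
  shows "(\<lambda>n. cut c d n t) \<longlonglongrightarrow> 1"
proof -
  \<comment> \<open>From \<open>N\<close> on both endpoints are farther away than
    \<open>2/n\<close>, so both ramps have reached one.\<close>
  obtain N :: nat where N: "2 / (t - c) + 2 / (d - t) < N"
    using reals_Archimedean2 by blast
  have "cut c d n t = 1" if "n \<ge> N" for n
  proof -
    have "0 < 2 / (t - c)" "0 < 2 / (d - t)" using assms by auto
    with N that have "2 / (t - c) < n" "2 / (d - t) < n" by linarith+
    then have "2 < n * (t - c)" "2 < n * (d - t)"
      using assms by (auto simp: field_simps)
    then show ?thesis unfolding cut_def by simp
  qed
  then show ?thesis
    by (intro tendsto_eventually eventually_sequentiallyI)
qed

text \<open>At each point at most one summand is nonzero, so the bounds and the limit are those of a
  single cutoff.\<close>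

lemma sum_cut:
  assumes "finite I" and disj: "disjoint_family_on (\<lambda>i. {c i<..<d i}) I"
  shows "0 \<le> (\<Sum>i\<in>I. cut (c i) (d i) n t)" "(\<Sum>i\<in>I. cut (c i) (d i) n t) \<le> 1"
    and "(\<lambda>n. \<Sum>i\<in>I. cut (c i) (d i) n t) \<longlonglongrightarrow> indicator (\<Union>i\<in>I. {c i<..<d i}) t"
proof -
  show "0 \<le> (\<Sum>i\<in>I. cut (c i) (d i) n t)" by (intro sum_nonneg cut_nonneg)
  have zero: "(\<Sum>i\<in>I. cut (c i) (d i) n t) = 0" if "t \<notin> (\<Union>i\<in>I. {c i<..<d i})" for n
    using that by (intro sum.neutral ballI cut_eq_zero) auto
  have one: "(\<Sum>i\<in>I. cut (c i) (d i) n t) = cut (c j) (d j) n t" if j: "j \<in> I" "t \<in> {c j<..<d j}" for n j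
  proof -
    have "cut (c i) (d i) n t = 0" if "i \<in> I - {j}" for i
    proof (rule cut_eq_zero)
      have "{c i<..<d i} \<inter> {c j<..<d j} = {}"
        by (rule disjoint_family_onD[OF disj]) (use j(1) that in auto)
      with j(2) show "t \<notin> {c i<..<d i}" by blast
    qed
    then show ?thesis
      using assms(1) j by (simp add: sum.remove)
  qed
  show "(\<Sum>i\<in>I. cut (c i) (d i) n t) \<le> 1"
    by (cases "t \<in> (\<Union>i\<in>I. {c i<..<d i})") (auto simp: one zero cut_le_one simp del: greaterThanLessThan_iff)
  show "(\<lambda>n. \<Sum>i\<in>I. cut (c i) (d i) n t) \<longlonglongrightarrow> indicator (\<Union>i\<in>I. {c i<..<d i}) t"
  proof (cases "t \<in> (\<Union>i\<in>I. {c i<..<d i})")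
    case True
    then obtain j where j: "j \<in> I" "t \<in> {c j<..<d j}" by blast
    show ?thesis
      unfolding one[OF j] using cut_tendsto[OF j(2)] True by simp
  next
    case False
    then show ?thesis unfolding zero[OF False] by simp
  qed
qed

section \<open>The functional is locally a multiple of integration\<close>

context local_functional
begin

text \<open>
  With \<open>w = \<phi> cnj \<psi>\<close> and \<open>G\<close> the antiderivative of \<open>k\<close>, the argument of \<open>Hat\<close> is \<open>(G / w)' + (G / w) w' / w\<close>.
\<close>

lemma Hat_zero_mean:
  assumes cd: "c < d" and nz: "\<And>t. t \<in> {c<..<d} \<Longrightarrow> \<phi> t \<noteq> 0 \<and> \<psi> t \<noteq> 0"
    and k: "csupp c d k" and int: "integral {c..d} k = 0"
  shows "Hat (\<lambda>t. k t * inverse (\<phi> t * cnj (\<psi> t))) = 0"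
proof -
  define w where "w t = \<phi> t * cnj (\<psi> t)" for t
  define w' where "w' t = \<phi> t * cnj (vderiv \<psi> t) + vderiv \<phi> t * cnj (\<psi> t)" for t
  have wnz: "w t \<noteq> 0" if "t \<in> {c<..<d}" for t using nz[OF that] by (simp add: w_def)
  have w: "(w has_vector_derivative w' t) (at t)" for t
    unfolding w_def w'_def using smooth_has_vderiv[OF smooth_\<phi>, of 0 t] smooth_has_vderiv[OF smooth_\<psi>, of 0 t]
    by (intro has_vector_derivative_mult has_vector_derivative_cnj) auto
  have wc: "continuous_on S w" "continuous_on S w'" for S
    unfolding w_def w'_def by (intro continuous_intros)+
  obtain G where G: "csupp c d G" "\<And>t. (G has_vector_derivative k t) (at t)"
    using csupp_antiderivative[OF k cd int] by blast
  let ?m = "\<lambda>t. inverse (w t)"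
  let ?m' = "\<lambda>t. w' t * - (?m t * ?m t)"
  let ?A = "\<lambda>t. G t * (vderiv \<phi> t * inverse (w t * \<phi> t))"
  let ?B = "\<lambda>t. G t * (cnj (vderiv \<psi> t) * inverse (w t * cnj (\<psi> t)))"
  have mc: "continuous_on {c<..<d} ?m"
    by (intro continuous_intros wc ballI wnz)
  have m'c: "continuous_on {c<..<d} ?m'"
    by (intro continuous_on_mult continuous_on_minus wc mc)
  have Ac: "continuous_on {c<..<d} (\<lambda>t. vderiv \<phi> t * inverse (w t * \<phi> t))"
    by (intro continuous_intros wc ballI) (simp add: wnz nz)
  have Bc: "continuous_on {c<..<d} (\<lambda>t. cnj (vderiv \<psi> t) * inverse (w t * cnj (\<psi> t)))"
    by (intro continuous_intros wc ballI) (simp add: wnz nz)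
  note supp = csupp_mult[OF G(1) m'c] csupp_mult[OF k mc] csupp_mult[OF G(1) Ac] csupp_mult[OF G(1) Bc]
  have "Hat (\<lambda>t. (G t * ?m' t + k t * ?m t) + ?A t + ?B t) = 0"
  proof (rule Hat_deriv[where g = "\<lambda>t. G t * ?m t" and g' = "\<lambda>t. G t * ?m' t + k t * ?m t"
        and a = ?A and b = ?B])
    fix t
    have "(?m has_vector_derivative ?m' t) (at t)" if "t \<in> {c<..<d}" for t
      using field_vector_diff_chain_at[OF w[of t] DERIV_inverse'[OF DERIV_ident wnz[OF that]]]
      by (simp add: o_def)
    then show "((\<lambda>t. G t * ?m t) has_vector_derivative G t * ?m' t + k t * ?m t) (at t within {-R..R})"
      by (rule has_vector_derivative_at_within[OF csupp_has_vector_derivative_mult[OF G(1) k G(2)]])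
    show "G t * ?m t * vderiv \<phi> t = ?A t * \<phi> t"
      using csupp_zero[OF G(1), of t] nz[of t] by (cases "t \<in> {c<..<d}") auto
    show "G t * ?m t * cnj (vderiv \<psi> t) = ?B t * cnj (\<psi> t)"
      using csupp_zero[OF G(1), of t] nz[of t] by (cases "t \<in> {c<..<d}") auto
  qed (intro continuous_on_add csupp_continuous_on[OF supp(1)] csupp_continuous_on[OF supp(2)]
      csupp_continuous_on[OF supp(3)] csupp_continuous_on[OF supp(4)])+
  \<comment> \<open>The logarithmic derivative of \<open>w\<close> is the sum of those of \<phi> and
    \<open>cnj \<psi>\<close>, so all terms with \<open>G\<close> cancel.\<close>
  moreover have "(G t * ?m' t + k t * ?m t) + ?A t + ?B t = k t * ?m t" for t
  proof (cases "t \<in> {c<..<d}")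
    case True
    then show ?thesis
      using nz[OF True] by (simp add: w_def w'_def field_simps)
  next
    case False
    then show ?thesis using csupp_zero[OF G(1) False] by simp
  qed
  ultimately have "Hat (\<lambda>t. k t * ?m t) = 0" by (simp only:)
  then show ?thesis by (simp only: w_def)
qed

text \<open>With \<open>w = \<phi> * cnj \<psi>\<close>, the map from \<open>k\<close> to
  \<open>Hat (k / w)\<close> kills functions of mean zero by \<open>Hat_zero_mean\<close>, so it is
  a multiple of the integral. The multiple is read off at the square of a cutoff, and then
  \<open>k = f * w\<close> is inserted.\<close>

lemma Hat_local:
  assumes cd: "c < d" and sub: "{c..d} \<subseteq> {-R..R}"
    and nz: "\<And>t. t \<in> {c<..<d} \<Longrightarrow> \<phi> t \<noteq> 0 \<and> \<psi> t \<noteq> 0"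
  shows "\<exists>\<kappa>. cmod \<kappa> \<le> 1 \<and>
    (\<forall>f. csupp c d f \<longrightarrow> Hat f = \<kappa> * integral {c..d} (\<lambda>t. f t * (\<phi> t * cnj (\<psi> t))))"
proof -
  let ?v = "\<lambda>t. inverse (\<phi> t * cnj (\<psi> t))"
  \<comment> \<open>Positivity of the cutoff at the midpoint ensures that its square has a nonzero
    integral.\<close>
  define m where "m = (c + d) / 2"
  have m: "m \<in> {c<..<d}" using cd by (simp add: m_def)
  have "\<forall>\<^sub>F n in sequentially. 0 < cut c d n m"
    by (rule order_tendstoD(1)[OF cut_tendsto[OF m]]) simp
  then obtain n where n: "0 < cut c d n m"
    by (auto simp: eventually_sequentially)
  define \<sigma> where "\<sigma> = cut c d n"
  have \<sigma>: "csupp c d (\<lambda>t. of_real (\<sigma> t))"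
    unfolding \<sigma>_def by (rule csupp_cut)
  define I where "I = integral {c..d} (\<lambda>t. (\<sigma> t)\<^sup>2)"
  have \<sigma>c: "continuous_on S (\<lambda>t. (\<sigma> t)\<^sup>2)" for S
    unfolding \<sigma>_def by (intro continuous_intros continuous_on_cut)
  then have \<sigma>i: "(\<lambda>t. (\<sigma> t)\<^sup>2) integrable_on {a..b}" for a b
    by (rule integrable_continuous_interval)
  have "I \<noteq> 0"
  proof
    assume "I = 0"
    then have "((\<lambda>t. (\<sigma> t)\<^sup>2) has_integral 0) (cbox c d)"
      using integrable_integral[OF \<sigma>i, of c d] by (simp add: I_def)
    from has_integral_0_cbox_imp_0[OF \<sigma>c _ this, of m] show False
      using m n cd by (simp add: \<sigma>_def)
  qed
  moreover have "0 \<le> I"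
    unfolding I_def by (intro integral_nonneg \<sigma>i) simp
  ultimately have I: "0 < I" by simp
  have Ic: "integral {c..d} (\<lambda>t. of_real (\<sigma> t) * of_real (\<sigma> t) :: complex) = of_real I"
    using has_integral_of_real[OF integrable_integral[OF \<sigma>i, of c d], where 'b = complex]
    by (intro integral_unique) (simp add: I_def power2_eq_square)
  have \<sigma>2: "csupp c d (\<lambda>t. of_real (\<sigma> t) * of_real (\<sigma> t))"
    by (intro csupp_mult[OF \<sigma>] csupp_continuous_on[OF \<sigma>])
  have vc: "continuous_on {c<..<d} ?v"
    using nz by (intro continuous_intros) auto
  define \<kappa> where "\<kappa> = Hat (\<lambda>t. of_real (\<sigma> t) * of_real (\<sigma> t) * ?v t) / of_real I"
  have mult: "Hat (\<lambda>t. k t * ?v t) = \<kappa> * integral {c..d} k" if k: "csupp c d k" for k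
  proof -
    define z where "z = integral {c..d} k / of_real I"
    let ?k = "\<lambda>t. k t - z * (of_real (\<sigma> t) * of_real (\<sigma> t))"
    have s: "csupp c d ?k" by (rule csupp_diff_cmult[OF k \<sigma>2])
    have "integral {c..d} ?k = integral {c..d} k - z * of_real I"
      unfolding Ic[symmetric] integral_mult_right[symmetric]
      by (intro Henstock_Kurzweil_Integration.integral_diff integrable_continuous_interval
          csupp_continuous_on[OF k] continuous_on_mult_left csupp_continuous_on[OF \<sigma>2])
    then have "integral {c..d} ?k = 0" using I by (simp add: z_def)
    then have "Hat (\<lambda>t. ?k t * ?v t) = 0"
      by (intro Hat_zero_mean[OF cd nz s])
    have "Hat (\<lambda>t. k t * ?v t) = Hat (\<lambda>t. ?k t * ?v t + z * (of_real (\<sigma> t) * of_real (\<sigma> t) * ?v t))"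
      by (rule arg_cong[where f = Hat]) (simp add: algebra_simps)
    also have "\<dots> = Hat (\<lambda>t. ?k t * ?v t) + Hat (\<lambda>t. z * (of_real (\<sigma> t) * of_real (\<sigma> t) * ?v t))"
      by (intro Hat_add continuous_on_mult_left csupp_continuous_on[OF csupp_mult[OF s vc]]
          csupp_continuous_on[OF csupp_mult[OF \<sigma>2 vc]])
    also have "Hat (\<lambda>t. z * (of_real (\<sigma> t) * of_real (\<sigma> t) * ?v t)) =
        z * Hat (\<lambda>t. of_real (\<sigma> t) * of_real (\<sigma> t) * ?v t)"
      by (rule Hat_cmult) (rule csupp_continuous_on[OF csupp_mult[OF \<sigma>2 vc]])
    also have "\<dots> = z * (\<kappa> * of_real I)"
      using I by (simp add: \<kappa>_def)
    finally show ?thesis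
      using I \<open>Hat (\<lambda>t. ?k t * ?v t) = 0\<close> by (simp add: z_def)
  qed
  have "cmod \<kappa> \<le> 1"
  proof -
    \<comment> \<open>The squared cutoff over \<open>w\<close> splits into these two factors.
      Multiplied by \<phi> and \<psi>, respectively, they have the modulus of the cutoff, so both
      norms in \<open>Hat_mult_bound\<close> equal \<open>sqrt I\<close>.\<close>
    let ?g = "\<lambda>t. of_real (\<sigma> t) * inverse (\<phi> t)" and ?h = "\<lambda>t. of_real (\<sigma> t) * inverse (cnj (\<psi> t))"
    have gc: "continuous_on {c<..<d} (\<lambda>t. inverse (\<phi> t))"
      by (intro continuous_intros ballI) (simp add: nz)
    have hc: "continuous_on {c<..<d} (\<lambda>t. inverse (cnj (\<psi> t)))"
      by (intro continuous_intros ballI) (simp add: nz)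
    note gh = csupp_mult[OF \<sigma> gc] csupp_mult[OF \<sigma> hc]
    have "(cmod (?g t * \<phi> t))\<^sup>2 = (\<sigma> t)\<^sup>2 \<and> (cmod (?h t * \<psi> t))\<^sup>2 = (\<sigma> t)\<^sup>2" for t
    proof (cases "t \<in> {c<..<d}")
      case True
      then have "\<phi> t \<noteq> 0" "\<psi> t \<noteq> 0" using nz by blast+
      then show ?thesis by (simp add: norm_mult norm_inverse mult.assoc)
    next
      case False
      then have "\<sigma> t = 0" using csupp_zero[OF \<sigma>, of t] by simp
      then show ?thesis by simp
    qed
    then have "energy (-R) R (\<lambda>t. ?g t * \<phi> t) = integral {-R..R} (\<lambda>t. (\<sigma> t)\<^sup>2)"
      "energy (-R) R (\<lambda>t. ?h t * \<psi> t) = integral {-R..R} (\<lambda>t. (\<sigma> t)\<^sup>2)"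
      unfolding energy_def by simp_all
    moreover have "integral {-R..R} (\<lambda>t. (\<sigma> t)\<^sup>2) = I"
      unfolding I_def
    proof (rule integral_spike_set)
      have e1: "{t \<in> {-R..R} - {c..d}. (\<sigma> t)\<^sup>2 \<noteq> 0} = {}"
        using csupp_zero[OF \<sigma>] by fastforce
      show "negligible {t \<in> {-R..R} - {c..d}. (\<sigma> t)\<^sup>2 \<noteq> 0}"
        unfolding e1 by simp
      have e2: "{t \<in> {c..d} - {-R..R}. (\<sigma> t)\<^sup>2 \<noteq> 0} = {}"
        using sub by blast
      show "negligible {t \<in> {c..d} - {-R..R}. (\<sigma> t)\<^sup>2 \<noteq> 0}"
        unfolding e2 by simp
    qed
    moreover have "Hat (\<lambda>t. of_real (\<sigma> t) * of_real (\<sigma> t) * ?v t) = Hat (\<lambda>t. ?g t * ?h t)"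
      by (rule arg_cong[where f = Hat]) (simp add: mult_ac)
    ultimately have "cmod (Hat (\<lambda>t. of_real (\<sigma> t) * of_real (\<sigma> t) * ?v t)) \<le> sqrt I * sqrt I"
      using Hat_mult_bound[OF csupp_continuous_on[OF gh(1)] csupp_continuous_on[OF gh(2)]] by simp
    then show ?thesis using I by (simp add: \<kappa>_def norm_divide)
  qed
  moreover have "Hat f = \<kappa> * integral {c..d} (\<lambda>t. f t * (\<phi> t * cnj (\<psi> t)))" if f: "csupp c d f" for f
  proof -
    have "csupp c d (\<lambda>t. f t * (\<phi> t * cnj (\<psi> t)))"
      by (intro csupp_mult[OF f] continuous_intros)
    from mult[OF this] have "Hat (\<lambda>t. f t * (\<phi> t * cnj (\<psi> t)) * ?v t) =
        \<kappa> * integral {c..d} (\<lambda>t. f t * (\<phi> t * cnj (\<psi> t)))" .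
    moreover have "f t * (\<phi> t * cnj (\<psi> t)) * ?v t = f t" for t
      using csupp_zero[OF f, of t] nz[of t] by (cases "t \<in> {c<..<d}") (auto simp: field_simps)
    ultimately show ?thesis by (simp only:)
  qed
  ultimately show ?thesis by blast
qed

text \<open>Dominated convergence: in \<open>X\<close> the factor tends to zero, and off
  \<open>X\<close> the function \<open>u\<close> is zero.\<close>

lemma nrm_cutoff_tendsto:
  assumes u: "\<And>S. continuous_on S u" and g: "\<And>n. continuous_on {-R..R} (g n)"
    and bnd: "\<And>n t. 0 \<le> g n t" "\<And>n t. g n t \<le> 1"
    and lim: "\<And>t. (\<lambda>n. g n t) \<longlonglongrightarrow> indicator X t" and X: "\<And>t. t \<notin> X \<Longrightarrow> u t = 0"
  shows "(\<lambda>n. nrm R (\<lambda>t. of_real (1 - g n t) * u t)) \<longlonglongrightarrow> 0"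
proof -
  have "(\<lambda>n. energy (-R) R (\<lambda>t. of_real (1 - g n t) * u t)) \<longlonglongrightarrow> integral {-R..R} (\<lambda>t. 0)"
    unfolding energy_def
  proof (rule dominated_convergence(2))
    show "(\<lambda>t. (cmod (of_real (1 - g n t) * u t))\<^sup>2) integrable_on {-R..R}" for n
      by (intro integrable_continuous_interval continuous_intros g u)
    show "(\<lambda>t. (cmod (u t))\<^sup>2) integrable_on {-R..R}"
      by (intro integrable_continuous_interval continuous_intros u)
    show "norm ((cmod (of_real (1 - g n t) * u t))\<^sup>2) \<le> (cmod (u t))\<^sup>2" for n t
    proof -
      have "cmod (of_real (1 - g n t)) \<le> 1"
        using bnd[of n t] unfolding norm_of_real by simp
      then have "cmod (of_real (1 - g n t) * u t) \<le> 1 * cmod (u t)"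
        unfolding norm_mult by (intro mult_right_mono) auto
      then show ?thesis by (simp add: power_mono)
    qed
    show "(\<lambda>n. (cmod (of_real (1 - g n t) * u t))\<^sup>2) \<longlonglongrightarrow> 0" for t
    proof -
      have "(\<lambda>n. (cmod (of_real (1 - g n t) * u t))\<^sup>2) \<longlonglongrightarrow> (cmod (of_real (1 - indicator X t) * u t))\<^sup>2"
        by (intro tendsto_intros lim)
      then show ?thesis using X[of t] by (cases "t \<in> X") auto
    qed
  qed
  then show ?thesis using tendsto_real_sqrt by fastforce
qed

text \<open>The product of the cutoffs for \<open>i\<close> and \<open>j\<close> has compact support
  in the intersection of the two intervals, where \<open>Hat_local\<close> applies. Summed over all
  pairs, these products replace 1 up to an error that tends to zero under the functional.\<close>

lemma functional_formula:
  fixes A :: "'i set" and B :: "'j set"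
  assumes fin: "finite A" "finite B"
    and disj: "disjoint_family_on (\<lambda>i. {\<alpha> i<..<\<beta> i}) A" "disjoint_family_on (\<lambda>j. {\<gamma> j<..<\<delta> j}) B"
    and sub: "\<And>i. i \<in> A \<Longrightarrow> {\<alpha> i..\<beta> i} \<subseteq> {-R..R}"
    and nz: "\<And>t. \<phi> t \<noteq> 0 \<longleftrightarrow> t \<in> (\<Union>i\<in>A. {\<alpha> i<..<\<beta> i})" "\<And>t. \<psi> t \<noteq> 0 \<longleftrightarrow> t \<in> (\<Union>j\<in>B. {\<gamma> j<..<\<delta> j})"
  shows "\<exists>\<kappa>. (\<forall>i\<in>A. \<forall>j\<in>B. cmod (\<kappa> i j) \<le> 1) \<and>
    L 1 = (\<Sum>i\<in>A. \<Sum>j\<in>B. \<kappa> i j * pairing (max (\<alpha> i) (\<gamma> j)) (min (\<beta> i) (\<delta> j)) \<phi> \<psi>)"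
proof -
  let ?c = "\<lambda>i j. max (\<alpha> i) (\<gamma> j)" and ?d = "\<lambda>i j. min (\<beta> i) (\<delta> j)"
  define P where "P i j \<kappa> \<longleftrightarrow> cmod \<kappa> \<le> 1 \<and> (\<forall>f. csupp (?c i j) (?d i j) f \<longrightarrow>
      Hat f = \<kappa> * integral {?c i j..?d i j} (\<lambda>t. f t * (\<phi> t * cnj (\<psi> t))))" for i j \<kappa>
  define \<kappa> where "\<kappa> i j = (SOME z. P i j z)" for i j
  have \<kappa>: "P i j (\<kappa> i j)" if ij: "i \<in> A" "j \<in> B" for i j
  proof -
    have "\<exists>z. P i j z"
    proof (cases "?c i j < ?d i j")
      case True
      show ?thesis
        unfolding P_def
      proof (rule Hat_local[OF True])
        show "{?c i j..?d i j} \<subseteq> {-R..R}"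
          by (rule subset_trans[OF _ sub[OF ij(1)]]) auto
        show "\<phi> t \<noteq> 0 \<and> \<psi> t \<noteq> 0" if "t \<in> {?c i j<..<?d i j}" for t
          using that ij nz by auto
      qed
    next
      case False
      have "f = (\<lambda>t. 0)" if f: "csupp (?c i j) (?d i j) f" for f
        using csupp_zero[OF f] False by (intro ext) (auto simp del: max_less_iff_conj min_less_iff_conj)
      then have "P i j 0" unfolding P_def by fastforce
      then show ?thesis by blast
    qed
    then show ?thesis unfolding \<kappa>_def by (rule someI_ex)
  qed
  define G where "G n t = (\<Sum>i\<in>A. cut (\<alpha> i) (\<beta> i) n t)" for n t
  define H where "H n t = (\<Sum>j\<in>B. cut (\<gamma> j) (\<delta> j) n t)" for n t
  have c: "continuous_on S (G n)" "continuous_on S (H n)" for S n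
    unfolding G_def H_def by (intro continuous_on_sum continuous_on_cut)+
  note G = sum_cut[OF fin(1) disj(1), folded G_def] and H = sum_cut[OF fin(2) disj(2), folded H_def]
  have "(\<lambda>n. Hat (\<lambda>t. of_real (G n t) * of_real (H n t))) \<longlonglongrightarrow>
      (\<Sum>i\<in>A. \<Sum>j\<in>B. \<kappa> i j * pairing (?c i j) (?d i j) \<phi> \<psi>)"
  proof -
    let ?f = "\<lambda>i j n t. of_real (cut (\<alpha> i) (\<beta> i) n t) * of_real (cut (\<gamma> j) (\<delta> j) n t) :: complex"
    have s: "csupp (?c i j) (?d i j) (?f i j n)" for i j n
      by (rule csupp_inter[OF csupp_cut csupp_cut])
    have "Hat (\<lambda>t. of_real (G n t) * of_real (H n t)) = (\<Sum>i\<in>A. \<Sum>j\<in>B. Hat (?f i j n))" for n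
    proof -
      have "Hat (\<lambda>t. of_real (G n t) * of_real (H n t)) = Hat (\<lambda>t. \<Sum>i\<in>A. \<Sum>j\<in>B. ?f i j n t)"
        by (simp add: G_def H_def sum_product)
      also have "\<dots> = (\<Sum>i\<in>A. \<Sum>j\<in>B. Hat (?f i j n))"
        by (simp add: Hat_sum continuous_on_sum csupp_continuous_on[OF s])
      finally show ?thesis .
    qed
    moreover have "(\<lambda>n. Hat (?f i j n)) \<longlonglongrightarrow> \<kappa> i j * pairing (?c i j) (?d i j) \<phi> \<psi>"
      if ij: "i \<in> A" "j \<in> B" for i j
    proof -
      let ?J = "{?c i j<..<?d i j}"
      have "(\<lambda>n. integral ?J (\<lambda>t. ?f i j n t * (\<phi> t * cnj (\<psi> t)))) \<longlonglongrightarrow> integral ?J (\<lambda>t. \<phi> t * cnj (\<psi> t))"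
      proof (rule dominated_convergence(2))
        show "(\<lambda>t. ?f i j n t * (\<phi> t * cnj (\<psi> t))) integrable_on ?J" for n
          unfolding integrable_on_open_interval_real
          by (intro integrable_continuous_interval continuous_intros csupp_continuous_on[OF csupp_cut])
        show "(\<lambda>t. cmod (\<phi> t * cnj (\<psi> t))) integrable_on ?J"
          unfolding integrable_on_open_interval_real
          by (intro integrable_continuous_interval continuous_intros)
        show "cmod (?f i j n t * (\<phi> t * cnj (\<psi> t))) \<le> cmod (\<phi> t * cnj (\<psi> t))" for n t
          using mult_left_le_one_le[of "cmod (\<phi> t * cnj (\<psi> t))" "cut (\<alpha> i) (\<beta> i) n t * cut (\<gamma> j) (\<delta> j) n t"]
            mult_le_one[OF cut_le_one[of "\<alpha> i" "\<beta> i" n t] cut_nonneg cut_le_one[of "\<gamma> j" "\<delta> j" n t]]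
          by (simp add: norm_mult cut_nonneg mult.assoc)
        show "(\<lambda>n. ?f i j n t * (\<phi> t * cnj (\<psi> t))) \<longlonglongrightarrow> \<phi> t * cnj (\<psi> t)" if t: "t \<in> ?J" for t
        proof -
          have "(\<lambda>n. ?f i j n t * (\<phi> t * cnj (\<psi> t))) \<longlonglongrightarrow> of_real 1 * of_real 1 * (\<phi> t * cnj (\<psi> t))"
            by (intro tendsto_intros cut_tendsto) (use t in auto)
          then show ?thesis by simp
        qed
      qed
      then have "(\<lambda>n. \<kappa> i j * integral {?c i j..?d i j} (\<lambda>t. ?f i j n t * (\<phi> t * cnj (\<psi> t)))) \<longlonglongrightarrow>
          \<kappa> i j * pairing (?c i j) (?d i j) \<phi> \<psi>"
        unfolding pairing_def integral_open_interval_real by (rule tendsto_mult_left)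
      then show ?thesis
        using \<kappa>[OF ij] s by (simp add: P_def)
    qed
    ultimately show ?thesis by (simp add: tendsto_sum)
  qed
  moreover have "(\<lambda>n. L 1 - Hat (\<lambda>t. of_real (G n t) * of_real (H n t))) \<longlonglongrightarrow> 0"
  proof (rule Lim_null_comparison)
    let ?g = "\<lambda>n. nrm R (\<lambda>t. of_real (1 - G n t) * \<phi> t)" and ?h = "\<lambda>n. nrm R (\<lambda>t. of_real (1 - H n t) * \<psi> t)"
    have "?g \<longlonglongrightarrow> 0" "?h \<longlonglongrightarrow> 0"
      using nz by (intro nrm_cutoff_tendsto[OF _ _ G] nrm_cutoff_tendsto[OF _ _ H] c cont; blast)+
    then show "(\<lambda>n. ?g n * nrm R \<psi> + nrm R \<phi> * ?h n) \<longlonglongrightarrow> 0"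
      using tendsto_add[OF tendsto_mult_right[of ?g 0 _ "nrm R \<psi>"] tendsto_mult_left[of ?h 0 _ "nrm R \<phi>"]]
      by simp
    show "\<forall>\<^sub>F n in sequentially. cmod (L 1 - Hat (\<lambda>t. of_real (G n t) * of_real (H n t))) \<le>
        ?g n * nrm R \<psi> + nrm R \<phi> * ?h n"
    proof (intro always_eventually allI)
      fix n
      have cc: "continuous_on {-R..R} (\<lambda>t. of_real (G n t) :: complex)" "continuous_on {-R..R} (\<lambda>t. of_real (H n t) :: complex)"
        "continuous_on {-R..R} (\<lambda>t. of_real (1 - G n t) :: complex)" "continuous_on {-R..R} (\<lambda>t. of_real (1 - H n t) :: complex)"
        by (intro continuous_intros c)+
      \<comment> \<open>The decomposition \<open>1 = (1 - G) + G * (1 - H) + G * H\<close>: the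
        first term is small against \<phi>, the second against \<psi>.\<close>
      let ?a = "\<lambda>t. of_real (1 - G n t) * 1 :: complex" and ?b = "\<lambda>t. of_real (G n t) * of_real (1 - H n t) :: complex"
      let ?e = "\<lambda>t. of_real (G n t) * of_real (H n t) :: complex"
      have abe: "continuous_on {-R..R} ?a" "continuous_on {-R..R} ?b" "continuous_on {-R..R} ?e"
        by (intro continuous_on_mult cc continuous_on_const)+
      have "L 1 = Hat (\<lambda>t. (?a t + ?b t) + ?e t)"
        unfolding Hat_one[symmetric] by (rule arg_cong[where f = Hat]) (simp add: algebra_simps)
      also have "\<dots> = (Hat ?a + Hat ?b) + Hat ?e"
        using Hat_add[OF continuous_on_add[OF abe(1,2)] abe(3)] Hat_add[OF abe(1,2)] by (simp only:)
      finally have "cmod (L 1 - Hat ?e) \<le> cmod (Hat ?a) + cmod (Hat ?b)"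
        by (simp add: norm_triangle_ineq)
      also have "cmod (Hat ?a) \<le> ?g n * nrm R \<psi>"
        using Hat_mult_bound[OF cc(3) continuous_on_const, of 1] by simp
      also have "cmod (Hat ?b) \<le> nrm R (\<lambda>t. of_real (G n t) * \<phi> t) * ?h n"
        by (rule Hat_mult_bound[OF cc(1,4)])
      also have "\<dots> \<le> nrm R \<phi> * ?h n"
      proof (intro mult_right_mono[OF nrm_mono nrm_nonneg] continuous_intros cont c)
        show "cmod (of_real (G n t) * \<phi> t) \<le> cmod (\<phi> t)" for t
          using G(1,2)[of n t] mult_left_le_one_le[of "cmod (\<phi> t)" "G n t"] by (simp add: norm_mult)
      qed
      finally show "cmod (L 1 - Hat ?e) \<le> ?g n * nrm R \<psi> + nrm R \<phi> * ?h n" by simp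
    qed
  qed
  ultimately have "(\<lambda>n. L 1) \<longlonglongrightarrow> (\<Sum>i\<in>A. \<Sum>j\<in>B. \<kappa> i j * pairing (?c i j) (?d i j) \<phi> \<psi>)"
    using tendsto_add by fastforce
  then have "L 1 = (\<Sum>i\<in>A. \<Sum>j\<in>B. \<kappa> i j * pairing (?c i j) (?d i j) \<phi> \<psi>)"
    by (simp add: LIMSEQ_const_iff)
  moreover have "\<forall>i\<in>A. \<forall>j\<in>B. cmod (\<kappa> i j) \<le> 1" using \<kappa> by (simp add: P_def)
  ultimately show ?thesis by blast
qed

end

section \<open>The transition probability\<close>

text \<open>Endpoints carry no mass, and for disjoint intervals both sides are zero.\<close>

lemma set_integral_eq_pairing:
  assumes "smooth u" "smooth v"
  shows "(LINT x:{a<..<b} \<inter> {c<..<d}|lborel. u x * cnj (v x)) = pairing (max a c) (min b d) u v"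
proof -
  let ?f = "\<lambda>x. u x * cnj (v x)"
  have J: "{a<..<b} \<inter> {c<..<d} = {max a c<..<min b d}" by auto
  have "set_integrable lborel {max a c..min b d} ?f"
    using assms by (intro borel_integrable_atLeastAtMost' continuous_intros smooth_continuous_on)
  then have "set_integrable lborel {max a c<..<min b d} ?f"
    by (rule set_integrable_subset) auto
  then show ?thesis
    unfolding J pairing_def integral_open_interval_real by (rule set_borel_integral_eq_integral)
qed

text \<open>An open interval that contains an endpoint of another one would meet it.\<close>

lemma disjoint_intervals_endpoints:
  fixes a b :: "'i \<Rightarrow> real"
  assumes less: "\<And>i. i \<in> I \<Longrightarrow> a i < b i" and disj: "disjoint_family_on (\<lambda>i. {a i<..<b i}) I"
    and k: "k \<in> I"
  shows "a k \<notin> (\<Union>i\<in>I. {a i<..<b i})" "b k \<notin> (\<Union>i\<in>I. {a i<..<b i})"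
proof -
  have False if i: "i \<in> I" and t: "t \<in> {a i<..<b i}" and "t = a k \<or> t = b k" for i t
  proof -
    have "i \<noteq> k" using that by auto
    then have "{a i<..<b i} \<inter> {a k<..<b k} = {}"
      by (intro disjoint_family_onD[OF disj] i k)
    moreover have "open {a i<..<b i}" "t \<in> closure {a k<..<b k}"
      using that less[OF k] by auto
    ultimately show False
      using t by (meson disjoint_iff open_Int_closure_eq_empty)
  qed
  then show "a k \<notin> (\<Union>i\<in>I. {a i<..<b i})" "b k \<notin> (\<Union>i\<in>I. {a i<..<b i})" by blast+
qed

lemma test_functions_bounded:
  assumes "f \<in> test_functions"
  obtains R where "0 < R" "\<And>t. f t \<noteq> 0 \<Longrightarrow> \<bar>t\<bar> < R"
proof -
  have "bounded {t. f t \<noteq> 0}"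
    using assms bounded_subset[OF compact_imp_bounded closure_subset] by (auto simp: test_functions_def)
  then obtain R where "0 < R" "\<And>t. f t \<noteq> 0 \<Longrightarrow> \<bar>t\<bar> \<le> R"
    unfolding bounded_pos by auto
  then show ?thesis
    \<comment> \<open>The summand 1 makes the bound strict, so that the nonzero set lies in an open
      interval.\<close>
    by (intro that[of "R + 1"]) fastforce+
qed

context representing_pair
begin

lemma ip_formula:
  fixes I :: "'i set" and J :: "'j set"
  assumes R: "0 < R" and fin: "finite I" "finite J"
    and disj: "disjoint_family_on (\<lambda>i. {\<alpha> i<..<\<beta> i}) I" "disjoint_family_on (\<lambda>j. {\<gamma> j<..<\<delta> j}) J"
    and sub: "\<And>i. i \<in> I \<Longrightarrow> {\<alpha> i..\<beta> i} \<subseteq> {-R..R}"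
    and nz: "\<And>t. \<phi> t \<noteq> 0 \<longleftrightarrow> t \<in> (\<Union>i\<in>I. {\<alpha> i<..<\<beta> i})" "\<And>t. \<psi> t \<noteq> 0 \<longleftrightarrow> t \<in> (\<Union>j\<in>J. {\<gamma> j<..<\<delta> j})"
  shows "\<exists>\<kappa>. (\<forall>i\<in>I. \<forall>j\<in>J. cmod (\<kappa> i j) \<le> 1) \<and>
    ip x y = (\<Sum>i\<in>I. \<Sum>j\<in>J. \<kappa> i j * pairing (max (\<alpha> i) (\<gamma> j)) (min (\<beta> i) (\<delta> j)) \<phi> \<psi>)"
proof -
  interpret local_functional \<phi> \<psi> R L
    by unfold_locales (intro R flat_off_smooth[OF \<phi>] flat_off_smooth[OF \<psi>] L_add L_smult
      L_mult_bound L_deriv_bound)+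
  have "ip x y = L 1"
    by (simp add: L_def rep_one x_carrier)
  with functional_formula[OF fin disj sub nz] show ?thesis by simp
qed

end

theorem theorem13:
  fixes \<phi> \<psi> :: "real \<Rightarrow> complex"
    and \<alpha> \<beta> \<gamma> \<delta> :: "nat \<Rightarrow> real" and r s :: nat
  assumes universe: "\<exists>h :: real \<Rightarrow> 'v. inj h"
    and "\<phi> \<in> test_functions" and "\<psi> \<in> test_functions"
    and "interval_condition \<phi> r \<alpha> \<beta>" and "interval_condition \<psi> s \<gamma> \<delta>"
  shows "transition_probability TYPE('v) (vector_functional \<phi>) (vector_functional \<psi>) =
    (\<Sum>k=1..r. \<Sum>l=1..s.
      cmod (LINT x:{\<alpha> k<..<\<beta> k} \<inter> {\<gamma> l<..<\<delta> l}|lborel. \<phi> x * cnj (\<psi> x)))\<^sup>2"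
proof -

  \<comment> \<open>The open sets carrying \<phi> and \<psi>, and a common bound\<close>
  define U where "U = (\<Union>k\<in>{1..r}. {\<alpha> k<..<\<beta> k})"
  define W where "W = (\<Union>l\<in>{1..s}. {\<gamma> l<..<\<delta> l})"
  have U: "\<And>k. k \<in> {1..r} \<Longrightarrow> \<alpha> k < \<beta> k" "disjoint_family_on (\<lambda>k. {\<alpha> k<..<\<beta> k}) {1..r}"
    "\<And>t. t \<in> U \<Longrightarrow> \<phi> t \<noteq> 0" "\<And>n t. t \<notin> U \<Longrightarrow> (vderiv ^^ n) \<phi> t = 0"
    using assms(4) by (auto simp: interval_condition_def U_def)
  have W: "\<And>l. l \<in> {1..s} \<Longrightarrow> \<gamma> l < \<delta> l" "disjoint_family_on (\<lambda>l. {\<gamma> l<..<\<delta> l}) {1..s}"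
    "\<And>t. t \<in> W \<Longrightarrow> \<psi> t \<noteq> 0" "\<And>n t. t \<notin> W \<Longrightarrow> (vderiv ^^ n) \<psi> t = 0"
    using assms(5) by (auto simp: interval_condition_def W_def)
  have nz: "\<phi> t \<noteq> 0 \<longleftrightarrow> t \<in> U" "\<psi> t \<noteq> 0 \<longleftrightarrow> t \<in> W" for t
    using U(3,4)[of t] U(4)[of t 0] W(3)[of t] W(4)[of t 0] by auto
  have \<phi>: "\<phi> \<in> flat_off U" by (rule test_function_flat_off[OF assms(2) U(4)]) (use U(3) in auto)
  have \<psi>: "\<psi> \<in> flat_off W" by (rule test_function_flat_off[OF assms(3) W(4)]) (use W(3) in auto)
  obtain R1 where R1: "0 < R1" "\<And>t. \<phi> t \<noteq> 0 \<Longrightarrow> \<bar>t\<bar> < R1"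
    using test_functions_bounded[OF assms(2)] by blast
  obtain R2 where R2: "0 < R2" "\<And>t. \<psi> t \<noteq> 0 \<Longrightarrow> \<bar>t\<bar> < R2"
    using test_functions_bounded[OF assms(3)] by blast
  define R where "R = max R1 R2"
  have R: "0 < R" using R1(1) by (simp add: R_def)
  have U_sub: "U \<subseteq> {-R<..<R}" and W_sub: "W \<subseteq> {-R<..<R}"
    using R1(2) R2(2) nz unfolding R_def by (fastforce simp: abs_less_iff less_max_iff_disj)+
  have sub: "{\<alpha> k..\<beta> k} \<subseteq> {-R..R}" if k: "k \<in> {1..r}" for k
  proof -
    have "{\<alpha> k<..<\<beta> k} \<subseteq> {-R<..<R}" using U_sub k unfolding U_def by blast
    then show ?thesis using U(1)[OF k] by (simp add: greaterThanLessThan_subseteq_greaterThanLessThan)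
  qed
  define C where "C k l = pairing (max (\<alpha> k) (\<gamma> l)) (min (\<beta> k) (\<delta> l)) \<phi> \<psi>" for k l
  define S where "S = (\<Sum>k=1..r. \<Sum>l=1..s. cmod (C k l))"
  have S: "0 \<le> S" unfolding S_def by (intro sum_nonneg) simp
  define X where "X = {(cmod (ip x y))\<^sup>2 | (V :: (complex, 'v) module) ip \<pi> x y.
      star_representation V ip \<pi> \<and>
      x \<in> representing_vectors V ip \<pi> (vector_functional \<phi>) \<and>
      y \<in> representing_vectors V ip \<pi> (vector_functional \<psi>)}"

  \<comment> \<open>Upper bound in an arbitrary representation\<close>
  have upper: "z \<le> S\<^sup>2" if "z \<in> X" for z
  proof -
    obtain V :: "(complex, 'v) module" and ip \<pi> x y where z: "z = (cmod (ip x y))\<^sup>2"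
      and rep: "star_representation V ip \<pi>"
      and x: "x \<in> representing_vectors V ip \<pi> (vector_functional \<phi>)"
      and y: "y \<in> representing_vectors V ip \<pi> (vector_functional \<psi>)"
      using \<open>z \<in> X\<close> unfolding X_def by blast
    interpret star_representation V ip \<pi> by (rule rep)
    interpret representing_pair V ip \<pi> \<phi> \<psi> U W R x y
      by unfold_locales (intro \<phi> \<psi> U_sub W_sub x y)+
    obtain \<kappa> where \<kappa>: "\<And>k l. k \<in> {1..r} \<Longrightarrow> l \<in> {1..s} \<Longrightarrow> cmod (\<kappa> k l) \<le> 1"
      and eq: "ip x y = (\<Sum>k=1..r. \<Sum>l=1..s. \<kappa> k l * C k l)"
      using ip_formula[OF R finite_atLeastAtMost finite_atLeastAtMost U(2) W(2) sub
          nz(1)[unfolded U_def] nz(2)[unfolded W_def]] unfolding C_def by blast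
    have "cmod (ip x y) \<le> S"
      unfolding eq S_def
      by (intro sum_norm_le) (simp add: norm_mult mult_left_le_one_le \<kappa>)
    then show ?thesis unfolding z by (intro power_mono) auto
  qed

  \<comment> \<open>Lower bound from glued representations\<close>
  have lower: "\<rho> * S\<^sup>2 \<in> X" if \<rho>: "0 < \<rho>" "\<rho> < 1" for \<rho>
  proof -
    \<comment> \<open>The phase turns each term of \<open>cross \<phi> \<psi>\<close> into
      \<open>sqrt \<rho> * cmod (C k l)\<close>, and the root becomes \<rho> on squaring. Where
      \<open>C k l\<close> is zero, so is the coefficient.\<close>
    define \<tau> where "\<tau> = (\<lambda>(k, l). of_real (sqrt \<rho>) * cnj (sgn (C k l)))"
    interpret glued_pair U W R "{1..r} \<times> {1..s}" "\<lambda>(k, l). max (\<alpha> k) (\<gamma> l)"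
      "\<lambda>(k, l). min (\<beta> k) (\<delta> l)" \<tau> "sqrt \<rho>"
    proof
      fix i assume i: "i \<in> {1..r} \<times> {1..s}"
      obtain k l where kl: "i = (k, l)" "k \<in> {1..r}" "l \<in> {1..s}" using i by blast
      \<comment> \<open>The endpoints of the intersection are among these four, each of which misses
        \<open>U\<close> or \<open>W\<close> and hence \<open>U \<inter> W\<close>.\<close>
      have "\<alpha> k \<notin> U" "\<beta> k \<notin> U" "\<gamma> l \<notin> W" "\<delta> l \<notin> W"
        unfolding U_def W_def
        using disjoint_intervals_endpoints[OF U(1,2) kl(2)] disjoint_intervals_endpoints[OF W(1,2) kl(3)]
        by blast+
      then show "(case i of (k, l) \<Rightarrow> max (\<alpha> k) (\<gamma> l)) \<notin> U \<inter> W"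
        "(case i of (k, l) \<Rightarrow> min (\<beta> k) (\<delta> l)) \<notin> U \<inter> W"
        by (auto simp: kl max_def min_def)
      show "{case i of (k, l) \<Rightarrow> max (\<alpha> k) (\<gamma> l)..case i of (k, l) \<Rightarrow> min (\<beta> k) (\<delta> l)} \<subseteq> {-R..R}"
        unfolding kl(1) prod.case by (rule subset_trans[OF _ sub[OF kl(2)]]) auto
      show "cmod (\<tau> i) \<le> sqrt \<rho>"
        using \<rho> by (simp add: kl \<tau>_def norm_mult norm_sgn)
    next
      show "disjoint_family_on (\<lambda>i. {case i of (k, l) \<Rightarrow> max (\<alpha> k) (\<gamma> l)<..<
          case i of (k, l) \<Rightarrow> min (\<beta> k) (\<delta> l)}) ({1..r} \<times> {1..s})"
      proof (unfold disjoint_family_on_def, intro ballI impI)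
        fix i j assume "i \<in> {1..r} \<times> {1..s}" "j \<in> {1..r} \<times> {1..s}" "i \<noteq> j"
        then obtain k l k' l' where ij: "i = (k, l)" "j = (k', l')"
          and kl: "k \<in> {1..r}" "l \<in> {1..s}" "k' \<in> {1..r}" "l' \<in> {1..s}" "\<not> (k = k' \<and> l = l')"
          by blast
        \<comment> \<open>Distinct pairs differ in one component, which already separates the
          intersections.\<close>
        have "{\<alpha> k<..<\<beta> k} \<inter> {\<alpha> k'<..<\<beta> k'} = {} \<or> {\<gamma> l<..<\<delta> l} \<inter> {\<gamma> l'<..<\<delta> l'} = {}"
          using kl disjoint_family_onD[OF U(2)] disjoint_family_onD[OF W(2)] by metis
        moreover have "{max (\<alpha> k) (\<gamma> l)<..<min (\<beta> k) (\<delta> l)} = {\<alpha> k<..<\<beta> k} \<inter> {\<gamma> l<..<\<delta> l}" for k l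
          by auto
        ultimately have "{max (\<alpha> k) (\<gamma> l)<..<min (\<beta> k) (\<delta> l)} \<inter>
            {max (\<alpha> k') (\<gamma> l')<..<min (\<beta> k') (\<delta> l')} = {}"
          by blast
        then show "{case i of (k, l) \<Rightarrow> max (\<alpha> k) (\<gamma> l)<..<case i of (k, l) \<Rightarrow> min (\<beta> k) (\<delta> l)} \<inter>
            {case j of (k, l) \<Rightarrow> max (\<alpha> k) (\<gamma> l)<..<case j of (k, l) \<Rightarrow> min (\<beta> k) (\<delta> l)} = {}"
          unfolding ij prod.case .
      qed
    qed (use R U_sub W_sub \<rho> in \<open>auto simp: real_sqrt_lt_1_iff\<close>)
    have "cross \<phi> \<psi> = of_real (sqrt \<rho> * S)"
    proof -
      have "cnj (sgn z) * z = of_real (cmod z)" for z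
        by (cases "z = 0") (simp_all add: sgn_eq complex_norm_square[symmetric] power2_eq_square mult.commute)
      then have "cross \<phi> \<psi> = (\<Sum>(k, l)\<in>{1..r} \<times> {1..s}. of_real (sqrt \<rho> * cmod (C k l)))"
        unfolding cross_def by (intro sum.cong) (auto simp: \<tau>_def C_def mult.assoc)
      then show ?thesis
        by (simp add: S_def sum_distrib_left flip: sum.cartesian_product)
    qed
    then have "(cmod (cross \<phi> \<psi>))\<^sup>2 = \<rho> * S\<^sup>2"
      using \<rho> S by (simp add: norm_mult power_mult_distrib del: of_real_mult)
    then show ?thesis
      using cross_mem[OF universe \<phi> \<psi>] unfolding X_def by simp
  qed
  have "Sup X = S\<^sup>2"
  proof (rule cSup_eq_non_empty)
    show "X \<noteq> {}" using lower[of "1/2"] by auto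
    \<comment> \<open>An upper bound dominates \<open>\<rho> * S\<^sup>2\<close> for all \<rho>
      between 0 and 1, hence also the limit as \<rho> tends to 1.\<close>
    show "S\<^sup>2 \<le> y" if "\<And>z. z \<in> X \<Longrightarrow> z \<le> y" for y
      by (rule field_le_mult_one_interval) (use that lower in blast)
  qed (rule upper)
  then show ?thesis
    unfolding transition_probability_def X_def[symmetric] S_def C_def
      set_integral_eq_pairing[OF flat_off_smooth[OF \<phi>] flat_off_smooth[OF \<psi>]] .
qed

end
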